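(* Let $X=Y=[0,1)$ with Lebesgue measure $\lambda$, and let $S_1:X\to X$, $S_2:Y\to Y$ be invertible $\lambda$-preserving transformations such that the $\mathbb{Z}$-systems $(S_1,X,\lambda)$ and $(S_2,Y,\lambda)$ are weakly mixing. With $\mathcal{M}$, $\mathrm{P}_{\mathcal{M}}$, $L_v$ and $\mu((0,v])$ as in the context, define the $\mathbb{R}^2$-action on $\hat\Omega=\mathcal{M}^2\times X\times Y$ by $$\hat L_{v,w}(\mu,\nu,x,y)=\big(L_v\mu,\ L_w\nu,\ S_1^{\mu((0,v])}x,\ S_2^{\nu((0,w])}y\big),\qquad (v,w)\in\mathbb{R}^2 .$$ Then the $\mathbb{R}^2$-system $\big((\hat L_{v,w})_{(v,w)\in\mathbb{R}^2},\hat\Omega,\mathrm{P}_{\mathcal{M}}^{\otimes 2}\otimes\lambda^{\otimes 2}\big)$ is weakly mixing.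
   Context: $\mathcal{M}$ is the space of locally finite configurations of points in $\mathbb{R}$ (identified with integer-valued measures all of whose atoms have mass $1$), $\mathrm{P}_{\mathcal{M}}$ is the law of the Poisson point process of intensity $1$ on $\mathbb{R}$, and for $\mu=\sum_i\delta_{a_i}$, $L_v\mu=\sum_i\delta_{a_i-v}$. For $v\ge0$, $\mu((0,v])$ is the number of points of $\mu$ in $(0,v]$; for $v<0$ it is minus the number of points of $\mu$ in $(v,0]$. A measure-preserving $G$-action ($G=\mathbb{Z}^d$ or $\mathbb{R}^d$) on $(\Omega,P)$ is weakly mixing if for all measurable $A,B$, $\lim_{R\to\infty}(2R)^{-d}\int_{|g|\le R}|P(T_gA\cap B)-P(A)P(B)|\,dg=0$ with $|g|=\max_i|g_i|$ and $dg$ Lebesgue (resp. counting) measure; equivalently the diagonal action on $\Omega\times\Omega$ is ergodic. *)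

theory Defs
  imports "HOL-Probability.Probability"
begin

definition measure_preserving :: "'a measure \<Rightarrow> 'b measure \<Rightarrow> ('a \<Rightarrow> 'b) set" where
  "measure_preserving M N = {T. T \<in> M \<rightarrow>\<^sub>M N \<and> distr M N T = N}"

text \<open>Locally finite configurations of points in the reals, represented as their
  (locally finite) support sets; these correspond exactly to integer-valued
  measures all of whose atoms have mass 1.\<close>
definition loc_finite :: "real set \<Rightarrow> bool" where
  "loc_finite A \<longleftrightarrow> (\<forall>B. bounded B \<longrightarrow> finite (A \<inter> B))"

definition config_space :: "real set measure" where
  "config_space = sigma {A. loc_finite A}
     {{A. loc_finite A \<and> card (A \<inter> B) = k} | B k. B \<in> sets borel \<and> bounded B}"

definition poisson_pp :: "real set measure \<Rightarrow> bool" where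
  "poisson_pp P \<longleftrightarrow> prob_space P \<and> sets P = sets config_space \<and> space P = space config_space \<and>
     (\<forall>(Bs :: nat \<Rightarrow> real set) (n::nat) (ks :: nat \<Rightarrow> nat).
        (\<forall>i<n. Bs i \<in> sets borel \<and> bounded (Bs i)) \<and> disjoint_family_on Bs {..<n} \<longrightarrow>
        measure P {A \<in> space P. \<forall>i<n. card (A \<inter> Bs i) = ks i}
          = (\<Prod>i<n. (measure lborel (Bs i)) ^ ks i / fact (ks i) * exp (- measure lborel (Bs i))))"

definition shift_conf :: "real \<Rightarrow> real set \<Rightarrow> real set" where
  "shift_conf v A = (\<lambda>a. a - v) ` A"

definition count_conf :: "real set \<Rightarrow> real \<Rightarrow> int" where
  "count_conf A v = (if v \<ge> 0 then int (card (A \<inter> {0<..v})) else - int (card (A \<inter> {v<..0})))"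

definition int_iter :: "('a \<Rightarrow> 'a) \<Rightarrow> ('a \<Rightarrow> 'a) \<Rightarrow> int \<Rightarrow> 'a \<Rightarrow> 'a" where
  "int_iter S Sinv n = (if n \<ge> 0 then S ^^ nat n else Sinv ^^ nat (- n))"

definition unit_leb :: "real measure" where
  "unit_leb = restrict_space lborel {0..<1}"

text \<open>Weak mixing of a measure-preserving Z-action T on a probability space M.
  Note: for an action, T_g A = T_(-g)^(-1) A.\<close>
definition weakly_mixing_Z :: "'a measure \<Rightarrow> (int \<Rightarrow> 'a \<Rightarrow> 'a) \<Rightarrow> bool" where
  "weakly_mixing_Z M T \<longleftrightarrow> prob_space M \<and> (\<forall>g. T g \<in> measure_preserving M M) \<and>
     (\<forall>A\<in>sets M. \<forall>B\<in>sets M.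
       ((\<lambda>R::real. (1 / (2 * R)) *
           (\<Sum>g\<in>{g::int. \<bar>real_of_int g\<bar> \<le> R}.
              \<bar>measure M (T (- g) -` A \<inter> space M \<inter> B) - measure M A * measure M B\<bar>))
        \<longlongrightarrow> 0) at_top)"

definition weakly_mixing_R2 :: "'a measure \<Rightarrow> (real \<times> real \<Rightarrow> 'a \<Rightarrow> 'a) \<Rightarrow> bool" where
  "weakly_mixing_R2 M T \<longleftrightarrow> prob_space M \<and> (\<forall>g. T g \<in> measure_preserving M M) \<and>
     (\<lambda>(g, \<omega>). T g \<omega>) \<in> (borel \<Otimes>\<^sub>M M) \<rightarrow>\<^sub>M M \<and>
     (\<forall>A\<in>sets M. \<forall>B\<in>sets M.
       ((\<lambda>R::real. (1 / (2 * R) ^ 2) *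
           integral (cbox (- R, - R) (R, R))
             (\<lambda>g. \<bar>measure M (T (- g) -` A \<inter> space M \<inter> B) - measure M A * measure M B\<bar>))
        \<longlongrightarrow> 0) at_top)"

end

theory Submission
  imports Defs "HOL-Real_Asymp.Real_Asymp"
begin

text \<open>
  Write \<open>N\<^sub>v\<close> for the signed number of points of \<open>\<mu>\<close> between \<open>0\<close> and \<open>v\<close>. For a single factor
  \<open>(\<mu>, x) \<mapsto> (L\<^sub>v \<mu>, S^N\<^sub>v x)\<close> and rectangles \<open>E \<times> F\<close>, \<open>E' \<times> F'\<close>, the overlap at time \<open>v\<close> is the
  expectation of \<open>1\<^sub>E\<^sub>'(\<mu>) 1\<^sub>E(L\<^sub>v \<mu>) c(N\<^sub>v)\<close>, where \<open>c(n)\<close> is the overlap of \<open>F\<close> and \<open>F'\<close> under \<open>S^n\<close>.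
  If \<open>E\<close> and \<open>E'\<close> are void events "no point in \<open>B\<close>", they are exactly independent once \<open>\<bar>v\<bar>\<close> is
  large, so the overlap differs from the product of the measures by at most the expectation of
  \<open>d(\<bar>N\<^sub>v\<bar>)\<close>, with \<open>d(n)\<close> the sum of the deviations of \<open>c(n)\<close> and \<open>c(-n)\<close> from the product of the
  measures of \<open>F\<close> and \<open>F'\<close>.
  Here \<open>\<bar>N\<^sub>v\<bar>\<close> is Poisson of parameter \<open>\<bar>v\<bar>\<close>. If \<open>D\<close> is the sequence of partial sums of \<open>d\<close>, then the
  derivative in \<open>t\<close> of the Poisson mean of \<open>D\<close> is the Poisson mean of \<open>d\<close>; weak mixing of \<open>S\<close> says
  \<open>D(n) = o(n)\<close>, hence the integral over \<open>[0, R]\<close> is \<open>o(R)\<close>.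

  For the two-parameter system the overlap of rectangles factorises into a function of \<open>v\<close> and a
  function of \<open>w\<close>. The void events are closed under intersection and, the configurations being simple,
  generate the \<open>\<sigma>\<close>-algebra; a Dynkin argument in each of the two sets extends the limit to all
  measurable sets.
\<close>

section \<open>Means over squares\<close>

text \<open>The average occurring in \<open>weakly_mixing_R2\<close>, as a function of the half side
  \<open>R\<close>.\<close>

definition square_mean :: "(real \<times> real \<Rightarrow> real) \<Rightarrow> real \<Rightarrow> real" where
  "square_mean f R = 1 / (2 * R)\<^sup>2 * integral (cbox (- R, - R) (R, R)) f"

lemma bounded_measurable_integrable_on_cbox:
  fixes f :: "'a::euclidean_space \<Rightarrow> real"
  assumes "f \<in> borel_measurable borel" and "\<And>x. \<bar>f x\<bar> \<le> K"
  shows "set_integrable lborel (cbox a b) f" "f integrable_on cbox a b"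
proof -
  show "set_integrable lborel (cbox a b) f"
    unfolding set_integrable_def
  proof (rule Bochner_Integration.integrable_bound)
    show "integrable lborel (\<lambda>x. indicator (cbox a b) x * K :: real)"
      by (intro integrable_mult_left integrable_real_indicator emeasure_bounded_finite bounded_cbox) auto
    show "(\<lambda>x. indicator (cbox a b) x *\<^sub>R f x) \<in> borel_measurable lborel"
      using assms(1) by simp
    show "AE x in lborel. norm (indicator (cbox a b) x *\<^sub>R f x) \<le> norm (indicator (cbox a b) x * K :: real)"
      using assms(2) by (intro AE_I2) (auto simp: indicator_def intro: order_trans[OF _ abs_ge_self])
  qed
  then show "f integrable_on cbox a b"
    by (rule set_borel_integral_eq_integral)
qed

lemma square_mean_nonneg:
  assumes "\<And>g. 0 \<le> f g"
  shows "0 \<le> square_mean f R"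
proof (cases "f integrable_on cbox (- R, - R) (R, R)")
  case True
  then show ?thesis
    unfolding square_mean_def using assms by (simp add: Henstock_Kurzweil_Integration.integral_nonneg)
next
  case False
  \<comment> \<open>Here \<open>integral\<close> takes its default value 0.\<close>
  then show ?thesis unfolding square_mean_def by (simp add: not_integrable_integral)
qed

text \<open>The constant \<open>C\<close> averages to itself because the square has area
  \<open>(2 * R)\<^sup>2\<close>. The lemma carries a pointwise bound of the form "finitely many
  pieces plus a uniform tail" over to averages; boundedness and measurability supply
  integrability.\<close>

lemma square_mean_le_sum:
  fixes n :: nat and h :: "nat \<Rightarrow> real \<times> real \<Rightarrow> real"
  assumes f: "f \<in> borel_measurable borel" "\<And>g. \<bar>f g\<bar> \<le> K"
    and h: "\<And>i. i < n \<Longrightarrow> h i \<in> borel_measurable borel" "\<And>i g. i < n \<Longrightarrow> \<bar>h i g\<bar> \<le> K"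
    and le: "\<And>g. f g \<le> (\<Sum>i<n. h i g) + C" and R: "R > 0"
  shows "square_mean f R \<le> (\<Sum>i<n. square_mean (h i) R) + C"
proof -
  let ?Q = "cbox (- R, - R) (R, R)"
  have int: "h i integrable_on ?Q" if "i < n" for i
    using bounded_measurable_integrable_on_cbox h that by blast
  have "integral ?Q f \<le> integral ?Q (\<lambda>g. (\<Sum>i<n. h i g) + C)"
    using int f le
    by (intro integral_le bounded_measurable_integrable_on_cbox[of f K] integrable_add integrable_sum) auto
  also have "\<dots> = (\<Sum>i<n. integral ?Q (h i)) + C * (2 * R)\<^sup>2"
    using int R by (subst Henstock_Kurzweil_Integration.integral_add)
      (auto intro!: integrable_sum Henstock_Kurzweil_Integration.integral_sum simp: content_Pair power2_eq_square)
  finally have "integral ?Q f \<le> (\<Sum>i<n. integral ?Q (h i)) + C * (2 * R)\<^sup>2" .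
  then have "1 / (2 * R)\<^sup>2 * integral ?Q f \<le> 1 / (2 * R)\<^sup>2 * ((\<Sum>i<n. integral ?Q (h i)) + C * (2 * R)\<^sup>2)"
    by (intro mult_left_mono) auto
  also have "\<dots> = (\<Sum>i<n. square_mean (h i) R) + C"
    using R by (simp add: square_mean_def distrib_left sum_distrib_left sum_divide_distrib)
  finally show ?thesis by (simp add: square_mean_def)
qed

text \<open>Applied to \<open>m g A = measure M (T (- g) -` A \<inter> space M \<inter> B)\<close> once with \<open>B\<close> fixed and once as a
  function of \<open>B\<close> with \<open>A\<close> fixed.\<close>

lemma square_mean_correlation_dynkin:
  fixes m :: "real \<times> real \<Rightarrow> 'a set \<Rightarrow> real"
  assumes M: "prob_space M" and G: "sets M = sigma_sets (space M) G" "Int_stable G" "G \<subseteq> Pow (space M)"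
    and meas: "\<And>A. A \<in> sets M \<Longrightarrow> (\<lambda>g. m g A) \<in> borel_measurable borel"
    and nonneg: "\<And>g A. A \<in> sets M \<Longrightarrow> 0 \<le> m g A"
    and le: "\<And>g A. A \<in> sets M \<Longrightarrow> m g A \<le> measure M A"
    and add: "\<And>g A B. A \<in> sets M \<Longrightarrow> B \<in> sets M \<Longrightarrow> A \<inter> B = {} \<Longrightarrow> m g (A \<union> B) = m g A + m g B"
    and total: "\<And>g. m g (space M) = \<kappa>"
    and base: "\<And>A. A \<in> G \<Longrightarrow> (square_mean (\<lambda>g. \<bar>m g A - \<kappa> * measure M A\<bar>) \<longlongrightarrow> 0) at_top"
    and A: "A \<in> sets M"
  shows "(square_mean (\<lambda>g. \<bar>m g A - \<kappa> * measure M A\<bar>) \<longlongrightarrow> 0) at_top"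
proof -
  interpret prob_space M by fact
  have k: "0 \<le> \<kappa>" "\<kappa> \<le> 1"
    using total[of 0] nonneg[of "space M" 0] le[of "space M" 0] prob_space by auto
  \<comment> \<open>Both terms lie between 0 and \<open>measure M A\<close>, so a set of small
    measure has a small deviation uniformly in \<open>g\<close>. This is what controls the tail of a
    countable union.\<close>
  have diff_le: "\<bar>m g A - \<kappa> * measure M A\<bar> \<le> measure M A" if "A \<in> sets M" for A g
  proof -
    have "\<kappa> * measure M A \<le> 1 * measure M A"
      using k by (intro mult_right_mono) auto
    moreover have "0 \<le> \<kappa> * measure M A" using k by auto
    ultimately show ?thesis using nonneg[OF that, of g] le[OF that, of g] by auto
  qed
  have diff_le1: "\<bar>m g A - \<kappa> * measure M A\<bar> \<le> 1" if "A \<in> sets M" for A g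
    using diff_le[OF that, of g] prob_le_1[of A] by linarith
  have fadd: "m g (\<Union>i<n. F i) = (\<Sum>i<n. m g (F i))"
    if "range F \<subseteq> sets M" "disjoint_family F" for F :: "nat \<Rightarrow> _" and n :: nat and g
  proof (induction n)
    case 0
    then show ?case using nonneg[of "{}" g] le[of "{}" g] by auto
  next
    case (Suc n)
    have "(\<Union>i<Suc n. F i) = (\<Union>i<n. F i) \<union> F n" by (auto simp: less_Suc_eq)
    moreover have "F i \<inter> F n = {}" if "i < n" for i
      using disjoint_family_onD[OF \<open>disjoint_family F\<close>, of i n] that by simp
    then have "(\<Union>i<n. F i) \<inter> F n = {}" by blast
    ultimately show ?case using Suc that(1) add[of "\<Union>i<n. F i" "F n" g] by auto
  qed
  have "A \<in> sigma_sets (space M) G" using A G by simp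
  with G(2,3) show ?thesis
  proof (induction A rule: sigma_sets_induct_disjoint)
    case (basic A)
    then show ?case by (rule base)
  next
    case empty
    have "m g {} = 0" for g using nonneg[of "{}" g] le[of "{}" g] by auto
    then show ?case by (simp add: square_mean_def)
  next
    case (compl A)
    then have A: "A \<in> sets M" using G by simp
    \<comment> \<open>Passing to the complement only changes the sign of the deviation, since
      \<open>m g\<close> has total mass \<kappa>.\<close>
    have "m g (space M - A) - \<kappa> * measure M (space M - A) = - (m g A - \<kappa> * measure M A)" for g
    proof -
      have "m g A + m g (space M - A) = \<kappa>"
        using add[of A "space M - A" g] A total[of g] sets.sets_into_space[OF A]
        by (simp add: Un_absorb1)
      then show ?thesis unfolding prob_compl[OF A] by (simp add: right_diff_distrib)
    qed
    then have "\<bar>m g (space M - A) - \<kappa> * measure M (space M - A)\<bar> = \<bar>m g A - \<kappa> * measure M A\<bar>" for g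
      by simp
    with compl show ?case by simp
  next
    case (union F)
    have F: "range F \<subseteq> sets M" using union(2) G by auto
    let ?U = "\<Union>i. F i" and ?h = "\<lambda>A g. \<bar>m g A - \<kappa> * measure M A\<bar>"
    have h_meas: "?h A \<in> borel_measurable borel" if "A \<in> sets M" for A
      using meas[OF that] by simp
    show ?case
    proof (rule tendstoI)
      fix e :: real assume e: "e > 0"
      \<comment> \<open>The tails of the union decrease to the empty set; the resulting cutoff
        \<open>n\<close> does not depend on \<open>g\<close>, so only finitely many averages have to
        converge.\<close>
      have "(\<lambda>n. measure M (?U - (\<Union>i<n. F i))) \<longlonglongrightarrow> measure M (\<Inter>n. ?U - (\<Union>i<n. F i))"
        using F by (intro finite_Lim_measure_decseq) (auto simp: decseq_def)
      moreover have "(\<Inter>n. ?U - (\<Union>i<n. F i)) = {}" by blast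
      ultimately have "(\<lambda>n. measure M (?U - (\<Union>i<n. F i))) \<longlonglongrightarrow> 0"
        by (simp only: measure_empty)
      then have "eventually (\<lambda>n. measure M (?U - (\<Union>i<n. F i)) < e / 2) sequentially"
        using e by (intro order_tendstoD) auto
      then obtain n where n: "measure M (?U - (\<Union>i<n. F i)) < e / 2"
        by (auto simp: eventually_sequentially)
      let ?T = "?U - (\<Union>i<n. F i)"
      have T: "?T \<in> sets M" using F by auto
      have bound: "?h ?U g \<le> (\<Sum>i<n. ?h (F i) g) + e / 2" for g
      proof -
        have U: "?U = (\<Union>i<n. F i) \<union> ?T" by auto
        have "m g ?U = (\<Sum>i<n. m g (F i)) + m g ?T"
          using fadd[OF F union(1), of g n] add[of "\<Union>i<n. F i" ?T g] F T by (subst U) auto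
        moreover have "measure M ?U = (\<Sum>i<n. measure M (F i)) + measure M ?T"
        proof -
          have "measure M ?U = measure M (\<Union>i<n. F i) + measure M ?T"
            using F T by (subst U, intro finite_measure_Union) auto
          also have "measure M (\<Union>i<n. F i) = (\<Sum>i<n. measure M (F i))"
            using F union(1) by (intro finite_measure_finite_Union) (auto simp: disjoint_family_on_def)
          finally show ?thesis .
        qed
        ultimately have "m g ?U - \<kappa> * measure M ?U
            = (\<Sum>i<n. m g (F i) - \<kappa> * measure M (F i)) + (m g ?T - \<kappa> * measure M ?T)"
          by (simp add: algebra_simps sum_subtractf sum_distrib_left)
        moreover have "\<bar>\<Sum>i<n. m g (F i) - \<kappa> * measure M (F i)\<bar> \<le> (\<Sum>i<n. ?h (F i) g)"
          by (rule sum_abs)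
        moreover have "?h ?T g < e / 2" using diff_le[OF T, of g] n by simp
        ultimately show ?thesis by linarith
      qed
      have "((\<lambda>R. \<Sum>i<n. square_mean (?h (F i)) R) \<longlongrightarrow> (\<Sum>i<n. 0)) at_top"
        using union(3) by (intro tendsto_sum) auto
      then have "eventually (\<lambda>R. (\<Sum>i<n. square_mean (?h (F i)) R) < e / 2) at_top"
        using e by (intro order_tendstoD) auto
      then show "eventually (\<lambda>R. dist (square_mean (?h ?U) R) 0 < e) at_top"
        using eventually_gt_at_top[of 0]
      proof eventually_elim
        case (elim R)
        have FM: "F i \<in> sets M" for i using F by auto
        then have UM: "?U \<in> sets M" by auto
        have "square_mean (?h ?U) R \<le> (\<Sum>i<n. square_mean (?h (F i)) R) + e / 2"
          using elim(2) h_meas[OF FM] h_meas[OF UM] diff_le1[OF FM] diff_le1[OF UM] bound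
          by (intro square_mean_le_sum[where K = 1]) simp_all
        moreover have "0 \<le> square_mean (?h ?U) R" by (rule square_mean_nonneg) simp
        ultimately show ?case using elim(1) by simp
      qed
    qed
  qed
qed

section \<open>Poisson means\<close>

text \<open>For \<open>t \<ge> 0\<close> this is the expectation of \<open>d\<close> at a Poisson
  variable of parameter \<open>t\<close>. As a power series it makes sense for all real
  \<open>t\<close> and can be differentiated termwise.\<close>

definition poisson_mean :: "(nat \<Rightarrow> real) \<Rightarrow> real \<Rightarrow> real" where
  "poisson_mean d t = exp (- t) * (\<Sum>n. d n / fact n * t ^ n)"

text \<open>Linear growth is dominated by \<open>2 ^ n\<close>, so the exponential series at
  \<open>2 * \<bar>t\<bar>\<close> is a majorant. Linear growth is the right class because the
  partial sums of a bounded sequence belong to it.\<close>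

lemma summable_poisson:
  fixes d :: "nat \<Rightarrow> real"
  assumes "\<And>n. \<bar>d n\<bar> \<le> K * (real n + 1)"
  shows "summable (\<lambda>n. d n / fact n * t ^ n)"
proof (rule summable_comparison_test')
  show "summable (\<lambda>n. K * (inverse (fact n) * (2 * \<bar>t\<bar>) ^ n))"
    by (intro summable_mult summable_exp)
  fix n
  have K: "0 \<le> K" using assms[of 0] by auto
  have "n + 1 \<le> 2 ^ n" by (simp add: Suc_leI)
  then have "real (n + 1) \<le> real (2 ^ n)" by (rule of_nat_mono)
  then have "real n + 1 \<le> 2 ^ n" by simp
  then have "K * (real n + 1) \<le> K * 2 ^ n" using K by (rule mult_left_mono)
  then have "\<bar>d n\<bar> \<le> K * 2 ^ n" using assms[of n] by linarith
  then have "\<bar>d n\<bar> * (inverse (fact n) * \<bar>t\<bar> ^ n) \<le> K * 2 ^ n * (inverse (fact n) * \<bar>t\<bar> ^ n)"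
    by (rule mult_right_mono) auto
  then show "norm (d n / fact n * t ^ n) \<le> K * (inverse (fact n) * (2 * \<bar>t\<bar>) ^ n)"
    by (simp add: abs_mult power_abs divide_inverse power_mult_distrib mult_ac)
qed

lemma poisson_mean_const: "poisson_mean (\<lambda>_. c) t = c"
proof -
  have "(\<lambda>n. c * (t ^ n /\<^sub>R fact n)) sums (c * exp t)"
    by (intro sums_mult exp_converges)
  then have "(\<lambda>n. c / fact n * t ^ n) sums (c * exp t)"
    by (simp add: field_simps)
  then show ?thesis by (simp add: poisson_mean_def sums_iff exp_minus)
qed

lemma poisson_mean_of_nat: "poisson_mean real t = t"
proof -
  have "(\<lambda>n. t * (t ^ n /\<^sub>R fact n)) sums (t * exp t)"
    by (intro sums_mult exp_converges)
  \<comment> \<open>The factor \<open>n\<close> cancels against \<open>fact n\<close>, so the series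
    for the mean is an exponential series shifted by one index; its zeroth term vanishes.\<close>
  also have "(\<lambda>n. t * (t ^ n /\<^sub>R fact n)) = (\<lambda>n. real (Suc n) / fact (Suc n) * t ^ Suc n)"
    by (rule ext) (simp add: field_simps del: of_nat_Suc)
  finally have "(\<lambda>n. real n / fact n * t ^ n) sums (t * exp t)"
    by (subst (asm) sums_Suc_iff) simp
  then show ?thesis by (simp add: poisson_mean_def sums_iff exp_minus)
qed

lemma poisson_mean_mono:
  assumes "\<And>n. \<bar>d n\<bar> \<le> K * (real n + 1)" "\<And>n. \<bar>d' n\<bar> \<le> K' * (real n + 1)"
    and "\<And>n. d n \<le> d' n" "t \<ge> 0"
  shows "poisson_mean d t \<le> poisson_mean d' t"
  unfolding poisson_mean_def
  using assms summable_poisson[OF assms(1)] summable_poisson[OF assms(2)]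
  by (intro mult_left_mono suminf_le) (auto intro!: mult_right_mono divide_right_mono)

lemma poisson_mean_affine: "poisson_mean (\<lambda>n. a * real n + b) t = a * t + b"
proof -
  have s: "summable (\<lambda>n. real n / fact n * t ^ n)" "summable (\<lambda>n. b / fact n * t ^ n)"
    by (rule summable_poisson[where K = 1]; simp) (rule summable_poisson[where K = "\<bar>b\<bar>"]; simp add: distrib_left)
  have "(\<Sum>n. a * (real n / fact n * t ^ n) + b / fact n * t ^ n)
      = a * (\<Sum>n. real n / fact n * t ^ n) + (\<Sum>n. b / fact n * t ^ n)"
    using suminf_add[OF summable_mult[OF s(1), of a] s(2)] suminf_mult[OF s(1), of a] by (simp only:)
  moreover have "a * (real n / fact n * t ^ n) + b / fact n * t ^ n = (a * real n + b) / fact n * t ^ n" for n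
    by (simp add: field_simps)
  ultimately have "poisson_mean (\<lambda>n. a * real n + b) t = a * poisson_mean real t + poisson_mean (\<lambda>_. b) t"
    by (simp add: poisson_mean_def algebra_simps)
  then show ?thesis by (simp add: poisson_mean_const poisson_mean_of_nat)
qed

text \<open>The forward equation of the Poisson process.\<close>

lemma DERIV_poisson_mean:
  assumes d: "\<And>n. \<bar>d n\<bar> \<le> K * (real n + 1)"
  shows "(poisson_mean d has_real_derivative poisson_mean (\<lambda>n. d (Suc n) - d n) t) (at t)"
proof -
  have K: "0 \<le> K" using d[of 0] by auto
  let ?S = "\<lambda>d t. \<Sum>n. d n / fact n * t ^ n"
  have d': "\<bar>d (Suc n)\<bar> \<le> 2 * K * (real n + 1)" for n
  proof -
    have "K * 1 \<le> K * (real n + 1)" using K by (intro mult_left_mono) auto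
    then show ?thesis using d[of "Suc n"] by (simp add: algebra_simps)
  qed
  note sm = summable_poisson[OF d] and sm' = summable_poisson[of "\<lambda>n. d (Suc n)", OF d']
  \<comment> \<open>Termwise differentiation of an exponential generating series shifts its
    coefficient sequence by one; the factor \<open>exp (- t)\<close> then contributes the subtracted
    \<open>d n\<close>.\<close>
  have "diffs (\<lambda>n. d n / fact n) = (\<lambda>n. d (Suc n) / fact n)"
    by (rule ext) (simp add: diffs_def field_simps del: of_nat_Suc)
  then have "(?S d has_real_derivative ?S (\<lambda>n. d (Suc n)) t) (at t)"
    using termdiffs_strong_converges_everywhere[OF sm, of t] by simp
  then have "((\<lambda>t. exp (- t) * ?S d t) has_real_derivative
      (exp (- t) * ?S (\<lambda>n. d (Suc n)) t - exp (- t) * ?S d t)) (at t)"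
    by (auto intro!: derivative_eq_intros)
  moreover have "?S (\<lambda>n. d (Suc n)) t - ?S d t = ?S (\<lambda>n. d (Suc n) - d n) t"
    using sm sm' by (subst suminf_diff) (auto simp: field_simps)
  ultimately show ?thesis
    by (simp add: poisson_mean_def[abs_def] right_diff_distrib[symmetric])
qed

text \<open>The function \<open>F\<close> is the Poisson mean of the partial sums \<open>D\<close>
  of \<open>d\<close>: by the forward equation its derivative is \<open>poisson_mean d\<close>. The
  Cesaro hypothesis gives \<open>D\<close> affine majorants of arbitrarily small slope, and the
  Poisson mean of an affine sequence is the same affine function of the parameter.\<close>

lemma poisson_mean_cesaro:
  assumes d: "\<And>n. 0 \<le> d n" "\<And>n. d n \<le> K"
    and lim: "(\<lambda>n. (\<Sum>k<n. d k) / real n) \<longlonglongrightarrow> 0"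
  obtains F where "\<And>R. R \<ge> 0 \<Longrightarrow>
      (\<integral>\<^sup>+t. ennreal (poisson_mean d t) * indicator {0..R} t \<partial>lborel) = ennreal (F R)"
    and "\<And>R. R \<ge> 0 \<Longrightarrow> 0 \<le> F R" and "((\<lambda>R. F R / R) \<longlongrightarrow> 0) at_top"
proof -
  define D where "D n = (\<Sum>k<n. d k)" for n
  have K: "0 \<le> K" using d[of 0] by linarith
  have D0: "0 \<le> D n" for n unfolding D_def using d by (intro sum_nonneg) auto
  have DK: "D n \<le> K * real n" for n
    unfolding D_def using sum_bounded_above[of "{..<n}" d K] d by (simp add: mult.commute)
  have Db: "\<bar>D n\<bar> \<le> K * (real n + 1)" for n using D0[of n] DK[of n] K by (simp add: distrib_left)
  have db: "\<bar>d n\<bar> \<le> K * (real n + 1)" for n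
    using d[of n] K mult_left_mono[of 1 "real n + 1" K] by simp
  have mean_nonneg: "0 \<le> poisson_mean f t" if "\<And>n. \<bar>f n\<bar> \<le> K * (real n + 1)" "\<And>n. 0 \<le> f n" "0 \<le> t" for f t
    using poisson_mean_mono[of "\<lambda>_. 0" 0 f K t] that by (simp add: poisson_mean_const)
  have "(\<lambda>n. D (Suc n) - D n) = d" by (auto simp: D_def)
  then have deriv: "(poisson_mean D has_real_derivative poisson_mean d t) (at t)" for t
    using DERIV_poisson_mean[of D, OF Db] by simp
  have [measurable]: "poisson_mean d \<in> borel_measurable borel"
    using DERIV_poisson_mean[of d, OF db]
    by (intro borel_measurable_continuous_onI continuous_at_imp_continuous_on ballI DERIV_isCont)
  have int: "(\<integral>\<^sup>+t. ennreal (poisson_mean d t) * indicator {0..R} t \<partial>lborel) = ennreal (poisson_mean D R)"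
    if "R \<ge> 0" for R
  proof -
    \<comment> \<open>At parameter 0 only the term \<open>n = 0\<close> could survive, and
      \<open>D 0\<close> is an empty sum.\<close>
    have "D n / fact n * 0 ^ n = 0" for n by (cases n) (auto simp: D_def)
    then have "poisson_mean D 0 = 0" by (simp only: poisson_mean_def suminf_zero mult_zero_right)
    then show ?thesis
      using nn_integral_FTC_Icc[of "poisson_mean d" 0 R "poisson_mean D"] deriv mean_nonneg[OF db d(1)] that
      by auto
  qed
  have "((\<lambda>R. poisson_mean D R / R) \<longlongrightarrow> 0) at_top"
  proof (rule tendstoI)
    fix e :: real assume e: "e > 0"
    have "eventually (\<lambda>n. D n / real n < e / 2) sequentially"
      using lim e by (intro order_tendstoD) (auto simp: D_def)
    then obtain N where N: "D n / real n < e / 2" if "n \<ge> N" for n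
      by (auto simp: eventually_sequentially)
    \<comment> \<open>This constant absorbs the indices below \<open>N\<close>, where only
      \<open>D n \<le> K * real n\<close> is available, and also \<open>n = 0\<close>, where the
      Cesaro quotient carries no information.\<close>
    define C where "C = K * real N"
    have C: "C \<ge> 0" using K by (simp add: C_def)
    have DD: "D n \<le> e / 2 * real n + C" for n
    proof (cases "n \<ge> N \<and> n > 0")
      case True
      then show ?thesis using N[of n] C by (simp add: field_simps)
    next
      case False
      then have "K * real n \<le> C" unfolding C_def using K by (intro mult_left_mono) auto
      moreover have "0 \<le> e / 2 * real n" using e by auto
      ultimately show ?thesis using DK[of n] by linarith
    qed
    have Db': "\<bar>e / 2 * real n + C\<bar> \<le> (e + C) * (real n + 1)" for n
      using mult_nonneg_nonneg[OF C, of "real n"] mult_nonneg_nonneg[of e "real n"] e C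
      by (simp add: distrib_left distrib_right)
    have "eventually (\<lambda>R. C / R < e / 2) at_top"
      using e by real_asymp
    then show "eventually (\<lambda>R. dist (poisson_mean D R / R) 0 < e) at_top"
      using eventually_gt_at_top[of 0]
    proof eventually_elim
      case (elim R)
      have "poisson_mean D R \<le> poisson_mean (\<lambda>n. e / 2 * real n + C) R"
        using elim by (intro poisson_mean_mono[OF Db Db'] DD) auto
      also have "\<dots> = e / 2 * R + C" by (rule poisson_mean_affine)
      finally have "poisson_mean D R / R \<le> e / 2 + C / R"
        using elim by (simp add: field_simps)
      moreover have "0 \<le> poisson_mean D R / R" using elim mean_nonneg[OF Db D0, of R] by simp
      ultimately show ?case using elim(1) by (simp only: dist_real_def diff_0_right abs_of_nonneg)
    qed
  qed
  then show ?thesis using that[of "poisson_mean D"] int mean_nonneg[OF Db D0] by blast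
qed

section \<open>The configuration space\<close>

text \<open>Void probabilities determine the law of a simple point process, so these events serve as
  the generator in all uniqueness and approximation arguments.\<close>

definition void_events :: "real set set set" where
  "void_events = {{A. loc_finite A \<and> A \<inter> B = {}} | B. B \<in> sets borel \<and> bounded B}"

lemma space_config_space: "space config_space = {A. loc_finite A}"
  unfolding config_space_def by (subst space_measure_of) auto

lemma sets_config_space:
  "sets config_space = sigma_sets {A. loc_finite A}
     {{A. loc_finite A \<and> card (A \<inter> B) = k} | B k. B \<in> sets borel \<and> bounded B}"
  unfolding config_space_def by (subst sets_measure_of) auto

lemma loc_finite_Int: "loc_finite A \<Longrightarrow> bounded B \<Longrightarrow> finite (A \<inter> B)"
  by (simp add: loc_finite_def)

lemma void_events_subset: "void_events \<subseteq> Pow {A. loc_finite A}"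
  by (auto simp: void_events_def)

text \<open>Having no point in \<open>B\<close> and none in \<open>C\<close> means having no point
  in \<open>B \<union> C\<close>.\<close>

lemma Int_stable_void_events: "Int_stable void_events"
proof (rule Int_stableI)
  fix a b assume "a \<in> void_events" "b \<in> void_events"
  then obtain B C where "a = {A. loc_finite A \<and> A \<inter> B = {}}" "B \<in> sets borel" "bounded B"
      "b = {A. loc_finite A \<and> A \<inter> C = {}}" "C \<in> sets borel" "bounded C"
    unfolding void_events_def by auto
  then show "a \<inter> b \<in> void_events"
    unfolding void_events_def by (intro CollectI exI[of _ "B \<union> C"]) auto
qed

lemma space_in_void_events: "{A. loc_finite A} \<in> void_events"
  unfolding void_events_def by (intro CollectI exI[of _ "{}"]) auto

text \<open>A finite set is separated by the cells of a sufficiently fine grid, so counting points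
  reduces to asking which cells are empty.\<close>

lemma card_ge_iff_grid:
  fixes X :: "real set"
  assumes "finite X"
  shows "k \<le> card X \<longleftrightarrow> (\<exists>n::nat. \<exists>J. finite J \<and> card J = k \<and> (\<forall>j\<in>J. X \<inter> {x. \<lfloor>real n * x\<rfloor> = j} \<noteq> {}))"
proof
  assume k: "k \<le> card X"
  \<comment> \<open>The inverse gaps between points of \<open>X\<close>. Once \<open>n\<close>
    dominates all of them, the mesh \<open>1 / n\<close> is at most every gap and no cell contains
    two points.\<close>
  define S where "S = (\<lambda>(x, y). inverse (y - x)) ` {p \<in> X \<times> X. fst p < snd p}"
  have "finite S" unfolding S_def using assms by (intro finite_imageI finite_Collect_conjI) auto
  then obtain n :: nat where n: "\<forall>s\<in>S. s \<le> real n"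
    using real_arch_simple[of "Max (insert 0 S)"] by (metis Max_ge finite_insert insertI2 order_trans)
  have inj: "inj_on (\<lambda>x. \<lfloor>real n * x\<rfloor>) X"
  proof (rule linorder_inj_onI)
    fix x y assume xy: "x < y" "x \<in> X" "y \<in> X"
    then have "inverse (y - x) \<le> real n"
      using n by (auto simp: S_def)
    then have "1 \<le> real n * (y - x)" using xy by (simp add: field_simps)
    then have "real n * x + 1 \<le> real n * y" by (simp add: algebra_simps)
    then show "\<lfloor>real n * x\<rfloor> \<noteq> \<lfloor>real n * y\<rfloor>" by linarith
  qed auto
  obtain Y where "Y \<subseteq> X" "card Y = k" "finite Y"
    using obtain_subset_with_card_n[OF k] by blast
  then show "\<exists>n::nat. \<exists>J. finite J \<and> card J = k \<and> (\<forall>j\<in>J. X \<inter> {x. \<lfloor>real n * x\<rfloor> = j} \<noteq> {})"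
    using card_image[OF inj_on_subset[OF inj]]
    by (intro exI[of _ n] exI[of _ "(\<lambda>x. \<lfloor>real n * x\<rfloor>) ` Y"]) auto
next
  assume "\<exists>n::nat. \<exists>J. finite J \<and> card J = k \<and> (\<forall>j\<in>J. X \<inter> {x. \<lfloor>real n * x\<rfloor> = j} \<noteq> {})"
  then obtain n :: nat and J where J: "card J = k" "\<forall>j\<in>J. X \<inter> {x. \<lfloor>real n * x\<rfloor> = j} \<noteq> {}" by blast
  then have "J \<subseteq> (\<lambda>x. \<lfloor>real n * x\<rfloor>) ` X" by fastforce
  then show "k \<le> card X"
    using J(1) card_mono[OF finite_imageI[OF assms]] card_image_le[OF assms] order_trans by blast
qed

text \<open>Having at least \<open>k\<close> points in \<open>B\<close> means hitting
  \<open>k\<close> cells of some grid: a countable union, over the mesh and over finite sets of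
  cells, of finite intersections of complements of void events. Exact counts are differences of two
  such events.\<close>

lemma sets_config_space_void: "sets config_space = sigma_sets {A. loc_finite A} void_events"
proof
  let ?\<Omega> = "{A. loc_finite A}"
  interpret V: sigma_algebra ?\<Omega> "sigma_sets ?\<Omega> void_events"
    using void_events_subset by (rule sigma_algebra_sigma_sets)
  have hit: "{A. loc_finite A \<and> A \<inter> B \<noteq> {}} \<in> sigma_sets ?\<Omega> void_events"
    if "B \<in> sets borel" "bounded B" for B
  proof -
    have "{A. loc_finite A \<and> A \<inter> B \<noteq> {}} = ?\<Omega> - {A. loc_finite A \<and> A \<inter> B = {}}" by auto
    moreover have "{A. loc_finite A \<and> A \<inter> B = {}} \<in> void_events"
      using that by (auto simp: void_events_def)
    ultimately show ?thesis by auto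
  qed
  have ge: "{A. loc_finite A \<and> k \<le> card (A \<inter> B)} \<in> sigma_sets ?\<Omega> void_events"
    if B: "B \<in> sets borel" "bounded B" for B k
  proof -
    define c where "c n j = B \<inter> {x. \<lfloor>real n * x\<rfloor> = j}" for n :: nat and j :: int
    have c: "c n j \<in> sets borel" "bounded (c n j)" for n j
      using B by (auto simp: c_def intro: bounded_subset)
    have "{A. loc_finite A \<and> k \<le> card (A \<inter> B)}
        = (\<Union>n. \<Union>J\<in>{J. finite J \<and> card J = k}. {A\<in>?\<Omega>. \<forall>j\<in>J. A \<inter> c n j \<noteq> {}})"
      using card_ge_iff_grid[OF loc_finite_Int[OF _ B(2)]] by (auto simp: c_def Int_assoc)
    also have "\<dots> \<in> sigma_sets ?\<Omega> void_events"
    proof (intro V.countable_UN'' V.countable_nat_UN image_subsetI)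
      have "countable {J :: int set. finite J}" by (rule countable_Collect_finite)
      then show "countable {J :: int set. finite J \<and> card J = k}"
        by (rule countable_subset[rotated]) auto
      fix n and J :: "int set" assume "J \<in> {J. finite J \<and> card J = k}"
      then have "finite J" by simp
      then show "{A\<in>?\<Omega>. \<forall>j\<in>J. A \<inter> c n j \<noteq> {}} \<in> sigma_sets ?\<Omega> void_events"
        using hit[OF c] by (intro V.sets_Collect_finite_All) auto
    qed auto
    finally show ?thesis .
  qed
  show "sets config_space \<subseteq> sigma_sets ?\<Omega> void_events"
    unfolding sets_config_space
  proof (rule V.sigma_sets_subset, safe)
    fix B :: "real set" and k assume B: "B \<in> sets borel" "bounded B"
    have "{A. loc_finite A \<and> card (A \<inter> B) = k}
        = {A. loc_finite A \<and> k \<le> card (A \<inter> B)} - {A. loc_finite A \<and> Suc k \<le> card (A \<inter> B)}"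
      by auto
    also have "\<dots> \<in> sigma_sets ?\<Omega> void_events" using ge[OF B] by (intro V.Diff)
    finally show "{A. loc_finite A \<and> card (A \<inter> B) = k} \<in> sigma_sets ?\<Omega> void_events" .
  qed
  show "sigma_sets ?\<Omega> void_events \<subseteq> sets config_space"
    unfolding sets_config_space
  proof (rule sigma_sets_mono, rule subsetI, rule sigma_sets.Basic)
    fix a assume "a \<in> void_events"
    then obtain B where B: "B \<in> sets borel" "bounded B" and a: "a = {A. loc_finite A \<and> A \<inter> B = {}}"
      by (auto simp: void_events_def)
    \<comment> \<open>Local finiteness matters here: \<open>card\<close> is also 0 on infinite
      sets.\<close>
    have "a = {A. loc_finite A \<and> card (A \<inter> B) = 0}"
      unfolding a using loc_finite_Int[OF _ B(2)] by auto
    with B show "a \<in> {{A. loc_finite A \<and> card (A \<inter> B) = k} |B k. B \<in> sets borel \<and> bounded B}" by blast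
  qed
qed

section \<open>Joint measurability of point counts, shifts and the counting cocycle\<close>

lemma measurable_card_Int:
  assumes "B \<in> sets borel" "bounded B"
  shows "(\<lambda>A. card (A \<inter> B)) \<in> config_space \<rightarrow>\<^sub>M count_space UNIV"
proof (subst measurable_count_space_eq2_countable, safe)
  fix k
  have "(\<lambda>A. card (A \<inter> B)) -` {k} \<inter> space config_space = {A. loc_finite A \<and> card (A \<inter> B) = k}"
    by (auto simp: space_config_space)
  then show "(\<lambda>A. card (A \<inter> B)) -` {k} \<inter> space config_space \<in> sets config_space"
    using assms unfolding sets_config_space by (auto intro!: sigma_sets.Basic)
qed auto

text \<open>A Dynkin argument in \<open>C\<close>. Counting measure replaces \<open>card\<close> so
  that disjoint unions become sums; the bounded window \<open>D\<close> keeps the counts finite, so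
  that complements become differences.\<close>

lemma measurable_emeasure_count_section:
  assumes C: "C \<in> sets (N \<Otimes>\<^sub>M borel)" and D: "D \<in> sets borel" "bounded D"
  shows "(\<lambda>(z, A). emeasure (count_space UNIV) (A \<inter> D \<inter> Pair z -` C))
    \<in> borel_measurable (N \<Otimes>\<^sub>M config_space)"
proof -
  let ?f = "\<lambda>C (z, A). emeasure (count_space UNIV) (A \<inter> D \<inter> Pair z -` C)"
  let ?G = "{a \<times> b |a b. a \<in> sets N \<and> b \<in> sets (borel :: real measure)}"
  have C': "C \<in> sigma_sets (space N \<times> UNIV) ?G" using C by (simp add: sets_pair_measure)
  have fin: "finite (A \<inter> D)" if "A \<in> space config_space" for A
    using loc_finite_Int[OF _ D(2)] that by (simp add: space_config_space)
  have rect: "?f (a \<times> b) \<in> borel_measurable (N \<Otimes>\<^sub>M config_space)"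
    if ab: "a \<in> sets N" "b \<in> sets borel" for a and b :: "real set"
  proof -
    have [measurable]: "(\<lambda>A. card (A \<inter> (D \<inter> b))) \<in> config_space \<rightarrow>\<^sub>M count_space UNIV"
      using ab D by (intro measurable_card_Int) (auto intro: bounded_subset)
    have "?f (a \<times> b) x = indicator a (fst x) * ennreal (real (card (snd x \<inter> (D \<inter> b))))"
      if "x \<in> space (N \<Otimes>\<^sub>M config_space)" for x
    proof -
      have "finite (snd x \<inter> D)" using fin that by (auto simp: space_pair_measure)
      then have "finite (snd x \<inter> D \<inter> b)" by simp
      then show ?thesis
        by (auto simp: split_beta indicator_def ennreal_of_nat_eq_real_of_nat Int_assoc)
    qed
    then show ?thesis using ab(1) by (subst measurable_cong) auto
  qed
  have "Int_stable ?G" by (rule Int_stable_pair_measure_generator)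
  moreover have "?G \<subseteq> Pow (space N \<times> UNIV)" using sets.sets_into_space by fastforce
  ultimately show ?thesis using C'
  proof (induction C rule: sigma_sets_induct_disjoint)
    case (basic C)
    then show ?case using rect by auto
  next
    case empty
    then show ?case by simp
  next
    case (compl C)
    have "?f (space N \<times> UNIV - C) x = ?f (space N \<times> UNIV) x - ?f C x"
      if "x \<in> space (N \<Otimes>\<^sub>M config_space)" for x
    proof -
      obtain z A where x: "x = (z, A)" by (cases x)
      have "finite (A \<inter> D)" "z \<in> space N" using fin that by (auto simp: x space_pair_measure)
      then have "emeasure (count_space UNIV) (A \<inter> D - A \<inter> D \<inter> Pair z -` C)
          = emeasure (count_space UNIV) (A \<inter> D) - emeasure (count_space UNIV) (A \<inter> D \<inter> Pair z -` C)"
        by (intro emeasure_Diff) auto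
      moreover have "A \<inter> D \<inter> Pair z -` (space N \<times> UNIV - C) = A \<inter> D - A \<inter> D \<inter> Pair z -` C"
        "A \<inter> D \<inter> Pair z -` (space N \<times> UNIV) = A \<inter> D"
        using \<open>z \<in> space N\<close> by auto
      ultimately show ?thesis by (simp add: x)
    qed
    then have "?f (space N \<times> UNIV - C) \<in> borel_measurable (N \<Otimes>\<^sub>M config_space)
        \<longleftrightarrow> (\<lambda>x. ?f (space N \<times> UNIV) x - ?f C x) \<in> borel_measurable (N \<Otimes>\<^sub>M config_space)"
      by (rule measurable_cong)
    moreover have "?f (space N \<times> UNIV) \<in> borel_measurable (N \<Otimes>\<^sub>M config_space)"
      by (rule rect) auto
    ultimately show ?case using compl(2) by (simp only: borel_measurable_minus_ennreal)
  next
    case (union F)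
    have "?f (\<Union>i. F i) = (\<lambda>x. \<Sum>i. ?f (F i) x)"
    proof
      fix x :: "'a \<times> real set"
      obtain z A where x: "x = (z, A)" by (cases x)
      have "disjoint_family (\<lambda>i. A \<inter> D \<inter> Pair z -` F i)"
        using union(1) by (auto simp: disjoint_family_on_def)
      then have "(\<Sum>i. emeasure (count_space UNIV) (A \<inter> D \<inter> Pair z -` F i))
          = emeasure (count_space UNIV) (\<Union>i. A \<inter> D \<inter> Pair z -` F i)"
        by (intro suminf_emeasure) auto
      also have "(\<Union>i. A \<inter> D \<inter> Pair z -` F i) = A \<inter> D \<inter> Pair z -` (\<Union>i. F i)" by auto
      finally show "?f (\<Union>i. F i) x = (\<Sum>i. ?f (F i) x)" by (simp add: x)
    qed
    then show ?case using union(3) by simp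
  qed
qed

text \<open>The windows \<open>{- real n..real n}\<close> exhaust the line, so the full count is the
  supremum of the windowed ones. Bounded sections make it finite, hence equal to
  \<open>card\<close>.\<close>

lemma measurable_card_section:
  assumes C: "C \<in> sets (N \<Otimes>\<^sub>M borel)" and bdd: "\<And>z. z \<in> space N \<Longrightarrow> bounded (Pair z -` C)"
  shows "(\<lambda>(z, A). card (A \<inter> Pair z -` C)) \<in> N \<Otimes>\<^sub>M config_space \<rightarrow>\<^sub>M count_space UNIV"
proof (subst measurable_count_space_eq2_countable, safe)
  fix k
  let ?f = "\<lambda>(z, A). emeasure (count_space UNIV) (A \<inter> Pair z -` C)"
  have "?f = (\<lambda>x. SUP n. (\<lambda>(z, A). emeasure (count_space UNIV) (A \<inter> {- real n..real n} \<inter> Pair z -` C)) x)"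
  proof
    fix x :: "'a \<times> real set"
    obtain z A where x: "x = (z, A)" by (cases x)
    have "(SUP n. emeasure (count_space UNIV) (A \<inter> {- real n..real n} \<inter> Pair z -` C))
        = emeasure (count_space UNIV) (\<Union>n. A \<inter> {- real n..real n} \<inter> Pair z -` C)"
      by (intro SUP_emeasure_incseq) (auto simp: incseq_def)
    also have "(\<Union>n. A \<inter> {- real n..real n} \<inter> Pair z -` C) = A \<inter> Pair z -` C"
    proof -
      have "\<exists>n. y \<in> {- real n..real n}" for y :: real
      proof -
        obtain n where "\<bar>y\<bar> \<le> real n" using real_arch_simple by blast
        then show ?thesis by (intro exI[of _ n]) auto
      qed
      then show ?thesis by blast
    qed
    finally show "?f x = (SUP n. (\<lambda>(z, A). emeasure (count_space UNIV) (A \<inter> {- real n..real n} \<inter> Pair z -` C)) x)"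
      by (simp add: x)
  qed
  then have meas: "?f \<in> borel_measurable (N \<Otimes>\<^sub>M config_space)"
    using measurable_emeasure_count_section[OF C] by (simp add: borel_measurable_SUP)
  have "(\<lambda>(z, A). card (A \<inter> Pair z -` C)) -` {k} \<inter> space (N \<Otimes>\<^sub>M config_space)
      = ?f -` {of_nat k} \<inter> space (N \<Otimes>\<^sub>M config_space)"
  proof (rule set_eqI)
    fix x :: "'a \<times> real set"
    obtain z A where x: "x = (z, A)" by (cases x)
    have "finite (A \<inter> Pair z -` C)" if "x \<in> space (N \<Otimes>\<^sub>M config_space)"
      using that bdd[of z] by (intro loc_finite_Int) (auto simp: x space_pair_measure space_config_space)
    then show "x \<in> (\<lambda>(z, A). card (A \<inter> Pair z -` C)) -` {k} \<inter> space (N \<Otimes>\<^sub>M config_space)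
        \<longleftrightarrow> x \<in> ?f -` {of_nat k} \<inter> space (N \<Otimes>\<^sub>M config_space)"
      by (auto simp: x)
  qed
  also have "\<dots> \<in> sets (N \<Otimes>\<^sub>M config_space)"
    using meas by (rule measurable_sets) auto
  finally show "(\<lambda>(z, A). card (A \<inter> Pair z -` C)) -` {k} \<inter> space (N \<Otimes>\<^sub>M config_space)
      \<in> sets (N \<Otimes>\<^sub>M config_space)" .
qed auto

lemma loc_finite_shift_conf: "loc_finite A \<Longrightarrow> loc_finite (shift_conf v A)"
  unfolding loc_finite_def shift_conf_def
proof (intro allI impI)
  fix B :: "real set" assume A: "\<forall>B. bounded B \<longrightarrow> finite (A \<inter> B)" and B: "bounded B"
  have "(\<lambda>a. a - v) ` A \<inter> B = (\<lambda>a. a - v) ` (A \<inter> (\<lambda>b. b + v) ` B)" by force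
  moreover have "bounded ((\<lambda>b. b + v) ` B)" using bounded_translation[OF B, of v] by (simp add: add.commute)
  ultimately show "finite ((\<lambda>a. a - v) ` A \<inter> B)" using A by auto
qed

text \<open>The shifted configuration has as many points in \<open>B\<close> as the original one has
  in the section at \<open>v\<close> of \<open>{(v, x). x - v \<in> B}\<close>, so the count over a
  moving region applies.\<close>

lemma measurable_shift_conf:
  "(\<lambda>(v, A). shift_conf v A) \<in> borel \<Otimes>\<^sub>M config_space \<rightarrow>\<^sub>M config_space"
proof (subst (2) config_space_def, rule measurable_measure_of)
  show "(\<lambda>(v, A). shift_conf v A) \<in> space (borel \<Otimes>\<^sub>M config_space) \<rightarrow> {A. loc_finite A}"
    by (auto simp: space_pair_measure space_config_space intro: loc_finite_shift_conf)
  fix Y assume "Y \<in> {{A. loc_finite A \<and> card (A \<inter> B) = k} |B k. B \<in> sets borel \<and> bounded B}"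
  then obtain B k where B: "B \<in> sets borel" "bounded B" and Y: "Y = {A. loc_finite A \<and> card (A \<inter> B) = k}"
    by blast
  define C where "C = {(v :: real, x). x - v \<in> B}"
  have "(\<lambda>z. snd z - fst z) -` B \<inter> space (borel \<Otimes>\<^sub>M borel) \<in> sets (borel \<Otimes>\<^sub>M borel)"
    by (rule measurable_sets[OF _ B(1)]) measurable
  also have "(\<lambda>z. snd z - fst z) -` B \<inter> space (borel \<Otimes>\<^sub>M borel) = C"
    by (auto simp: C_def space_pair_measure)
  finally have C: "C \<in> sets (borel \<Otimes>\<^sub>M borel)" .
  have "Pair v -` C = (\<lambda>b. v + b) ` B" for v
    by (force simp: C_def image_iff)
  then have bdd: "bounded (Pair v -` C)" for v using bounded_translation[OF B(2)] by simp
  have "card (shift_conf v A \<inter> B) = card (A \<inter> Pair v -` C)" for v A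
  proof -
    have "shift_conf v A \<inter> B = (\<lambda>a. a - v) ` (A \<inter> Pair v -` C)"
      by (auto simp: shift_conf_def C_def)
    then show ?thesis by (simp add: card_image inj_on_def)
  qed
  then have "(\<lambda>(v, A). shift_conf v A) -` Y \<inter> space (borel \<Otimes>\<^sub>M config_space)
      = (\<lambda>(v, A). card (A \<inter> Pair v -` C)) -` {k} \<inter> space (borel \<Otimes>\<^sub>M config_space)"
    unfolding Y by (auto simp: space_pair_measure space_config_space loc_finite_shift_conf)
  also have "\<dots> \<in> sets (borel \<Otimes>\<^sub>M config_space)"
    by (rule measurable_sets[OF measurable_card_section[OF C bdd]]) auto
  finally show "(\<lambda>(v, A). shift_conf v A) -` Y \<inter> space (borel \<Otimes>\<^sub>M config_space)
      \<in> sets (borel \<Otimes>\<^sub>M config_space)" .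
qed auto

text \<open>Both intervals in \<open>count_conf\<close> are bounded sections at \<open>v\<close> of
  Borel subsets of the plane.\<close>

lemma measurable_count_conf:
  "(\<lambda>(v, A). count_conf A v) \<in> borel \<Otimes>\<^sub>M config_space \<rightarrow>\<^sub>M count_space UNIV"
proof -
  have [measurable]: "(\<lambda>(v, A). card (A \<inter> Pair v -` {(v, x). 0 < x \<and> x \<le> v})) \<in> borel \<Otimes>\<^sub>M config_space \<rightarrow>\<^sub>M count_space UNIV"
    "(\<lambda>(v, A). card (A \<inter> Pair v -` {(v, x). v < x \<and> x \<le> 0})) \<in> borel \<Otimes>\<^sub>M config_space \<rightarrow>\<^sub>M count_space UNIV"
  proof -
    have "Pair v -` {(v, x). 0 < x \<and> x \<le> v} = {0<..v}" "Pair v -` {(v, x). v < x \<and> x \<le> 0} = {v<..0}" for v :: real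
      by auto
    then have bdd: "bounded (Pair v -` {(v, x). 0 < x \<and> x \<le> v})" "bounded (Pair v -` {(v, x). v < x \<and> x \<le> 0})" for v :: real
      by auto
    have "{(v, x). 0 < x \<and> x \<le> v} = {z \<in> space (borel \<Otimes>\<^sub>M borel). 0 < snd z \<and> snd z \<le> (fst z :: real)}"
      "{(v, x). v < x \<and> x \<le> 0} = {z \<in> space (borel \<Otimes>\<^sub>M borel). fst z < snd z \<and> snd z \<le> (0 :: real)}"
      by (auto simp: space_pair_measure)
    then have "{(v :: real, x). 0 < x \<and> x \<le> v} \<in> sets (borel \<Otimes>\<^sub>M borel)" "{(v :: real, x). v < x \<and> x \<le> 0} \<in> sets (borel \<Otimes>\<^sub>M borel)"
      by simp_all
    then show "(\<lambda>(v, A). card (A \<inter> Pair v -` {(v, x). 0 < x \<and> x \<le> v})) \<in> borel \<Otimes>\<^sub>M config_space \<rightarrow>\<^sub>M count_space UNIV"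
      "(\<lambda>(v, A). card (A \<inter> Pair v -` {(v, x). v < x \<and> x \<le> 0})) \<in> borel \<Otimes>\<^sub>M config_space \<rightarrow>\<^sub>M count_space UNIV"
      using bdd by (simp_all only: measurable_card_section)
  qed
  have "(\<lambda>z. if fst z \<ge> 0 then int ((\<lambda>(v, A). card (A \<inter> Pair v -` {(v, x). 0 < x \<and> x \<le> v})) z)
      else - int ((\<lambda>(v, A). card (A \<inter> Pair v -` {(v, x). v < x \<and> x \<le> 0})) z)) \<in> borel \<Otimes>\<^sub>M config_space \<rightarrow>\<^sub>M count_space UNIV"
    by measurable
  also have "(\<lambda>z. if fst z \<ge> 0 then int ((\<lambda>(v, A). card (A \<inter> Pair v -` {(v, x). 0 < x \<and> x \<le> v})) z)
      else - int ((\<lambda>(v, A). card (A \<inter> Pair v -` {(v, x). v < x \<and> x \<le> 0})) z)) = (\<lambda>(v, A). count_conf A v)"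
    by (auto simp: fun_eq_iff count_conf_def intro!: arg_cong[of _ _ card])
  finally show ?thesis .
qed

section \<open>The Poisson process\<close>

text \<open>Moves the shift from the configuration to the test set. The form \<open>b - - v\<close>
  matches \<open>translate_bounded_borel\<close> taken at \<open>- v\<close>.\<close>

lemma shift_conf_Int_empty_iff: "shift_conf v A \<inter> B = {} \<longleftrightarrow> A \<inter> (\<lambda>b. b - - v) ` B = {}"
proof -
  have "shift_conf v A \<inter> B = (\<lambda>a. a - v) ` (A \<inter> (\<lambda>b. b - - v) ` B)"
    by (force simp: shift_conf_def)
  then show ?thesis by simp
qed

lemma translate_bounded_borel:
  fixes B :: "real set"
  assumes "B \<in> sets borel" "bounded B"
  shows "(\<lambda>b. b - v) ` B \<in> sets borel" "bounded ((\<lambda>b. b - v) ` B)"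
    "measure lborel ((\<lambda>b. b - v) ` B) = measure lborel B"
proof -
  have "(\<lambda>b. b + v) -` B \<inter> space borel \<in> sets borel"
    by (rule measurable_sets[OF _ assms(1)]) measurable
  also have "(\<lambda>b. b + v) -` B \<inter> space borel = (\<lambda>b. b - v) ` B" by force
  finally show b: "(\<lambda>b. b - v) ` B \<in> sets borel" .
  show "bounded ((\<lambda>b. b - v) ` B)"
    using bounded_translation[OF assms(2), of "- v"] by simp
  show "measure lborel ((\<lambda>b. b - v) ` B) = measure lborel B"
    using measure_translation_subtract[of v B] assms(1) b by (simp add: measure_completion)
qed

locale poisson_process =
  fixes P :: "real set measure"
  assumes poisson: "poisson_pp P"
begin

sublocale prob_space P
  using poisson by (simp add: poisson_pp_def)

lemma sets_P[measurable_cong]: "sets P = sets config_space"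
  and space_P: "space P = {A. loc_finite A}"
  using poisson by (simp_all add: poisson_pp_def space_config_space)

lemma prob_card:
  assumes "B \<in> sets borel" "bounded B"
  shows "prob {A \<in> space P. card (A \<inter> B) = k} = measure lborel B ^ k / fact k * exp (- measure lborel B)"
proof -
  have "\<forall>(Bs :: nat \<Rightarrow> real set) n ks. (\<forall>i<n. Bs i \<in> sets borel \<and> bounded (Bs i)) \<and> disjoint_family_on Bs {..<n} \<longrightarrow>
      prob {A \<in> space P. \<forall>i<n. card (A \<inter> Bs i) = ks i}
        = (\<Prod>i<n. (measure lborel (Bs i)) ^ ks i / fact (ks i) * exp (- measure lborel (Bs i)))"
    using poisson unfolding poisson_pp_def by blast
  from this[rule_format, of "Suc 0" "\<lambda>_. B" "\<lambda>_. k"] assms show ?thesis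
    by (simp add: disjoint_family_on_def)
qed

lemma prob_void:
  assumes "B \<in> sets borel" "bounded B"
  shows "prob {A. loc_finite A \<and> A \<inter> B = {}} = exp (- measure lborel B)"
proof -
  have "{A. loc_finite A \<and> A \<inter> B = {}} = {A \<in> space P. card (A \<inter> B) = 0}"
    using loc_finite_Int[OF _ assms(2)] by (auto simp: space_P)
  then show ?thesis using prob_card[OF assms, of 0] by simp
qed

lemma void_events_sets: "E \<in> void_events \<Longrightarrow> E \<in> sets P"
  unfolding sets_P sets_config_space_void by (rule sigma_sets.Basic)

lemma measurable_shift[measurable]: "shift_conf v \<in> P \<rightarrow>\<^sub>M P"
  using measurable_Pair_compose_split[OF measurable_shift_conf, of "\<lambda>_. v" P "\<lambda>x. x"]
  by (simp add: measurable_cong_sets[OF refl sets_P] measurable_ident_sets[OF sets_P])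

lemma vimage_shift_void:
  assumes "E = {A. loc_finite A \<and> A \<inter> B = {}}"
  shows "shift_conf v -` E \<inter> space P = {A. loc_finite A \<and> A \<inter> (\<lambda>b. b - - v) ` B = {}}"
  unfolding assms space_P by (auto simp: shift_conf_Int_empty_iff intro: loc_finite_shift_conf)

text \<open>A void probability depends only on the Lebesgue measure of the test set, which is
  translation invariant; agreement on the intersection-stable generator then suffices.\<close>

lemma distr_shift: "distr P P (shift_conf v) = P"
proof (rule measure_eqI_generator_eq[OF Int_stable_void_events void_events_subset])
  fix E assume E: "E \<in> void_events"
  then obtain B where B: "B \<in> sets borel" "bounded B" and EB: "E = {A. loc_finite A \<and> A \<inter> B = {}}"
    by (auto simp: void_events_def)
  have "prob (shift_conf v -` E \<inter> space P) = prob E"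
    unfolding vimage_shift_void[OF EB] using prob_void[OF translate_bounded_borel(1,2)[OF B, of "- v"]]
      prob_void[OF B] translate_bounded_borel(3)[OF B, of "- v"] EB by simp
  then show "emeasure (distr P P (shift_conf v)) E = emeasure P E"
    using void_events_sets[OF E] by (simp add: emeasure_distr emeasure_eq_measure)
next
  show "range (\<lambda>_. {A. loc_finite A}) \<subseteq> void_events" using space_in_void_events by auto
  show "emeasure (distr P P (shift_conf v)) {A. loc_finite A} \<noteq> \<infinity>" for i :: nat
    by (simp add: emeasure_distr space_P[symmetric] emeasure_eq_measure)
qed (auto simp: sets_P sets_config_space_void)

text \<open>Once the translate of \<open>B\<close> is disjoint from \<open>B'\<close>, the joint
  event is the void event of their union, and the exponential turns additivity of Lebesgue measure
  into a product.\<close>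

lemma shift_void_independent:
  assumes "E \<in> void_events" "E' \<in> void_events"
  obtains r where "r \<ge> 0" "\<And>v. \<bar>v\<bar> > r \<Longrightarrow> prob (shift_conf v -` E \<inter> space P \<inter> E') = prob E * prob E'"
proof -
  from assms obtain B B' where B: "B \<in> sets borel" "bounded B" and E: "E = {A. loc_finite A \<and> A \<inter> B = {}}"
    and B': "B' \<in> sets borel" "bounded B'" and E': "E' = {A. loc_finite A \<and> A \<inter> B' = {}}"
    by (auto simp: void_events_def)
  obtain a where a: "\<And>x. x \<in> B \<Longrightarrow> \<bar>x\<bar> \<le> a" using B(2) by (auto simp: bounded_iff)
  obtain b where b: "\<And>x. x \<in> B' \<Longrightarrow> \<bar>x\<bar> \<le> b" using B'(2) by (auto simp: bounded_iff)
  show ?thesis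
  \<comment> \<open>The absolute values keep the threshold nonnegative even for an empty test set,
    whose bound may be negative.\<close>
  proof (rule that[of "\<bar>a\<bar> + \<bar>b\<bar>"])
    fix v :: real assume v: "\<bar>v\<bar> > \<bar>a\<bar> + \<bar>b\<bar>"
    let ?Bv = "(\<lambda>b. b - - v) ` B"
    note Bv = translate_bounded_borel[OF B, of "- v"]
    have disj: "?Bv \<inter> B' = {}" using a b v by fastforce
    have fin: "emeasure lborel ?Bv \<noteq> \<infinity>" "emeasure lborel B' \<noteq> \<infinity>"
      using emeasure_bounded_finite[OF Bv(2)] emeasure_bounded_finite[OF B'(2)] by auto
    have "shift_conf v -` E \<inter> space P \<inter> E' = {A. loc_finite A \<and> A \<inter> (?Bv \<union> B') = {}}"
      unfolding vimage_shift_void[OF E] E' by auto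
    then have "prob (shift_conf v -` E \<inter> space P \<inter> E') = exp (- measure lborel (?Bv \<union> B'))"
      using Bv B' by (simp only: prob_void sets.Un bounded_Un)
    also have "measure lborel (?Bv \<union> B') = measure lborel B + measure lborel B'"
      using Bv B' disj fin by (subst measure_Union) auto
    finally show "prob (shift_conf v -` E \<inter> space P \<inter> E') = prob E * prob E'"
      using prob_void[OF B] prob_void[OF B'] E E' by (simp add: mult_exp_exp)
  qed auto
qed

lemma measurable_card_P[measurable (raw)]:
  assumes "B \<in> sets borel" "bounded B"
  shows "(\<lambda>A. card (A \<inter> B)) \<in> P \<rightarrow>\<^sub>M count_space UNIV"
  using measurable_card_Int[OF assms] by (simp add: measurable_cong_sets[OF sets_P refl])

text \<open>Splitting over the values of the count turns the expectation into the defining series of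
  \<open>poisson_mean\<close>.\<close>

lemma nn_integral_card:
  fixes d :: "nat \<Rightarrow> real"
  assumes B: "B \<in> sets borel" "bounded B" and d: "\<And>n. 0 \<le> d n" "\<And>n. d n \<le> K"
  shows "(\<integral>\<^sup>+A. ennreal (d (card (A \<inter> B))) \<partial>P) = ennreal (poisson_mean d (measure lborel B))"
proof -
  note [measurable] = measurable_card_P[OF B]
  let ?t = "measure lborel B"
  let ?S = "\<lambda>n. {A \<in> space P. card (A \<inter> B) = n}"
  have K: "0 \<le> K" using d[of 0] by linarith
  have db: "\<bar>d n\<bar> \<le> K * (real n + 1)" for n
    using d[of n] K mult_left_mono[of 1 "real n + 1" K] by simp
  have "(\<integral>\<^sup>+A. ennreal (d (card (A \<inter> B))) \<partial>P) = (\<integral>\<^sup>+A. (\<Sum>n. ennreal (d n) * indicator (?S n) A) \<partial>P)"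
  proof (rule nn_integral_cong)
    fix A assume "A \<in> space P"
    then have "(\<Sum>n. ennreal (d n) * indicator (?S n) A) = (\<Sum>n\<in>{card (A \<inter> B)}. ennreal (d n) * indicator (?S n) A)"
      by (intro suminf_finite) auto
    then show "ennreal (d (card (A \<inter> B))) = (\<Sum>n. ennreal (d n) * indicator (?S n) A)"
      using \<open>A \<in> space P\<close> by simp
  qed
  also have "\<dots> = (\<Sum>n. \<integral>\<^sup>+A. ennreal (d n) * indicator (?S n) A \<partial>P)"
    by (rule nn_integral_suminf) measurable
  also have "\<dots> = (\<Sum>n. ennreal (exp (- ?t) * (d n / fact n * ?t ^ n)))"
  proof (rule suminf_cong)
    fix n
    have "(\<integral>\<^sup>+A. ennreal (d n) * indicator (?S n) A \<partial>P) = ennreal (d n) * emeasure P (?S n)"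
      by (rule nn_integral_cmult_indicator) measurable
    also have "\<dots> = ennreal (d n * prob (?S n))"
      using d by (simp add: emeasure_eq_measure ennreal_mult)
    also have "d n * prob (?S n) = exp (- ?t) * (d n / fact n * ?t ^ n)"
      by (simp add: prob_card[OF B])
    finally show "(\<integral>\<^sup>+A. ennreal (d n) * indicator (?S n) A \<partial>P) = ennreal (exp (- ?t) * (d n / fact n * ?t ^ n))" .
  qed
  also have "\<dots> = ennreal (\<Sum>n. exp (- ?t) * (d n / fact n * ?t ^ n))"
    using d summable_poisson[OF db] by (intro suminf_ennreal2 summable_mult) auto
  also have "(\<Sum>n. exp (- ?t) * (d n / fact n * ?t ^ n)) = poisson_mean d ?t"
    unfolding poisson_mean_def using summable_poisson[OF db] by (rule suminf_mult)
  finally show ?thesis .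
qed

text \<open>For either sign of \<open>v\<close>, the absolute count is the number of points in a
  half-open interval of length \<open>\<bar>v\<bar>\<close>.\<close>

lemma nn_integral_abs_count_conf:
  fixes d :: "nat \<Rightarrow> real"
  assumes "\<And>n. 0 \<le> d n" "\<And>n. d n \<le> K"
  shows "(\<integral>\<^sup>+A. ennreal (d (nat \<bar>count_conf A v\<bar>)) \<partial>P) = ennreal (poisson_mean d \<bar>v\<bar>)"
proof (cases "v \<ge> 0")
  case True
  then show ?thesis using nn_integral_card[of "{0<..v}" d K] assms by (simp add: count_conf_def)
next
  case False
  then show ?thesis using nn_integral_card[of "{v<..0}" d K] assms by (simp add: count_conf_def)
qed

lemma measurable_count_conf_P[measurable]: "(\<lambda>A. count_conf A v) \<in> P \<rightarrow>\<^sub>M count_space UNIV"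
  using measurable_Pair_compose_split[OF measurable_count_conf, of "\<lambda>_. v" P "\<lambda>x. x"]
  by (simp add: measurable_ident_sets[OF sets_P])

end

section \<open>One skew product\<close>

text \<open>One of the two factors of the system, with the iterates of an invertible map replaced by
  a family \<open>U\<close> that is weakly mixing in the sense of
  \<open>weakly_mixing_Z\<close>.\<close>

locale poisson_skew_product = poisson_process P for P +
  fixes N :: "'b measure" and U :: "int \<Rightarrow> 'b \<Rightarrow> 'b"
  assumes U_mixing: "weakly_mixing_Z N U"
begin

definition skew :: "real \<Rightarrow> real set \<times> 'b \<Rightarrow> real set \<times> 'b" where
  "skew v = (\<lambda>(A, x). (shift_conf v A, U (count_conf A v) x))"

definition skew_overlap :: "(real set \<times> 'b) set \<Rightarrow> (real set \<times> 'b) set \<Rightarrow> real \<Rightarrow> (real set \<times> 'b) set" where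
  "skew_overlap X Y v = skew v -` X \<inter> space (P \<Otimes>\<^sub>M N) \<inter> Y"

definition base_corr :: "'b set \<Rightarrow> 'b set \<Rightarrow> int \<Rightarrow> real" where
  "base_corr F F' n = measure N (U n -` F \<inter> space N \<inter> F')"

sublocale N: prob_space N
  using U_mixing by (simp add: weakly_mixing_Z_def)

sublocale pair: pair_prob_space P N ..

lemma U_measurable[measurable]: "U n \<in> N \<rightarrow>\<^sub>M N"
  using U_mixing by (simp add: weakly_mixing_Z_def measure_preserving_def)

lemma distr_U: "distr N N (U n) = N"
  using U_mixing by (simp add: weakly_mixing_Z_def measure_preserving_def)

lemma measurable_skew: "(\<lambda>(v, \<omega>). skew v \<omega>) \<in> borel \<Otimes>\<^sub>M (P \<Otimes>\<^sub>M N) \<rightarrow>\<^sub>M P \<Otimes>\<^sub>M N"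
proof -
  have [measurable]: "(\<lambda>(v, A). shift_conf v A) \<in> borel \<Otimes>\<^sub>M P \<rightarrow>\<^sub>M P"
      "(\<lambda>(v, A). count_conf A v) \<in> borel \<Otimes>\<^sub>M P \<rightarrow>\<^sub>M count_space UNIV"
    using measurable_shift_conf measurable_count_conf
    by (simp_all cong: measurable_cong_sets add: sets_P sets_pair_measure_cong[OF refl sets_P])
  \<comment> \<open>The exponent is random but takes values in the countable type
    \<open>int\<close>, so measurability of each single \<open>U n\<close> suffices.\<close>
  have "(\<lambda>z. U ((\<lambda>(v, A). count_conf A v) (fst z, fst (snd z))) (snd (snd z))) \<in> borel \<Otimes>\<^sub>M (P \<Otimes>\<^sub>M N) \<rightarrow>\<^sub>M N"
    by (rule measurable_compose_countable) measurable
  moreover have "(\<lambda>z. (\<lambda>(v, A). shift_conf v A) (fst z, fst (snd z))) \<in> borel \<Otimes>\<^sub>M (P \<Otimes>\<^sub>M N) \<rightarrow>\<^sub>M P"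
    by measurable
  ultimately have "(\<lambda>z. ((\<lambda>(v, A). shift_conf v A) (fst z, fst (snd z)),
      U ((\<lambda>(v, A). count_conf A v) (fst z, fst (snd z))) (snd (snd z)))) \<in> borel \<Otimes>\<^sub>M (P \<Otimes>\<^sub>M N) \<rightarrow>\<^sub>M P \<Otimes>\<^sub>M N"
    by (rule measurable_Pair[rotated])
  then show ?thesis by (simp add: skew_def split_beta')
qed

lemma measurable_skew1[measurable]: "skew v \<in> P \<Otimes>\<^sub>M N \<rightarrow>\<^sub>M P \<Otimes>\<^sub>M N"
  using measurable_Pair_compose_split[OF measurable_skew, of "\<lambda>_. v" "P \<Otimes>\<^sub>M N" "\<lambda>x. x"] by simp

lemma skew_overlap_sets:
  assumes "X \<in> sets (P \<Otimes>\<^sub>M N)" "Y \<in> sets (P \<Otimes>\<^sub>M N)"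
  shows "skew_overlap X Y v \<in> sets (P \<Otimes>\<^sub>M N)"
  unfolding skew_overlap_def using measurable_sets[OF measurable_skew1 assms(1)] assms(2) by auto

section \<open>Overlaps of rectangles in one skew product\<close>

lemma base_corr_bounds: "0 \<le> base_corr F F' n" "base_corr F F' n \<le> 1"
  by (auto simp: base_corr_def)

text \<open>Fubini over the configuration: the fibre of the overlap above \<open>A\<close> is empty
  unless \<open>A \<in> H v\<close>, and otherwise it is the overlap of \<open>F\<close> and
  \<open>F'\<close> at the exponent \<open>count_conf A v\<close>.\<close>

lemma measure_skew_overlap:
  assumes E: "E \<in> sets P" "E' \<in> sets P" and F: "F \<in> sets N" "F' \<in> sets N"
  defines "H \<equiv> \<lambda>v. shift_conf v -` E \<inter> space P \<inter> E'"
  shows "measure (P \<Otimes>\<^sub>M N) (skew_overlap (E \<times> F) (E' \<times> F') v)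
    = (\<integral>A. indicator (H v) A * base_corr F F' (count_conf A v) \<partial>P)"
proof -
  have H[measurable]: "H v \<in> sets P" unfolding H_def using measurable_sets[OF measurable_shift E(1)] E(2) by auto
  have c[measurable]: "(\<lambda>A. base_corr F F' (count_conf A v)) \<in> borel_measurable P"
    by (rule measurable_compose[OF measurable_count_conf_P]) simp
  let ?S = "skew_overlap (E \<times> F) (E' \<times> F') v"
  have S: "?S \<in> sets (P \<Otimes>\<^sub>M N)" using E F by (intro skew_overlap_sets) auto
  have "emeasure (P \<Otimes>\<^sub>M N) ?S = (\<integral>\<^sup>+A. emeasure N (Pair A -` ?S) \<partial>P)"
    by (rule N.emeasure_pair_measure_alt[OF S])
  also have "\<dots> = (\<integral>\<^sup>+A. ennreal (indicator (H v) A * base_corr F F' (count_conf A v)) \<partial>P)"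
  proof (rule nn_integral_cong)
    fix A assume A: "A \<in> space P"
    show "emeasure N (Pair A -` ?S) = ennreal (indicator (H v) A * base_corr F F' (count_conf A v))"
    proof (cases "A \<in> H v")
      case True
      then have "Pair A -` ?S = U (count_conf A v) -` F \<inter> space N \<inter> F'"
        by (auto simp: skew_overlap_def skew_def H_def space_pair_measure)
      then show ?thesis using True by (simp add: base_corr_def N.emeasure_eq_measure)
    next
      case False
      then have "Pair A -` ?S = {}"
        by (auto simp: skew_overlap_def skew_def H_def space_pair_measure)
      then show ?thesis using False by simp
    qed
  qed
  also have "\<dots> = ennreal (\<integral>A. indicator (H v) A * base_corr F F' (count_conf A v) \<partial>P)"
    using base_corr_bounds by (intro nn_integral_eq_integral integrable_const_bound[where B = 1])
      (auto simp: indicator_def)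
  finally show ?thesis
    using base_corr_bounds by (simp add: measure_def integral_nonneg_AE)
qed

text \<open>With the whole space as second rectangle, \<open>base_corr\<close> is constant by
  invariance of \<open>N\<close>, and invariance of \<open>P\<close> under the shift does the rest.
  This yields measure preservation of the full system.\<close>

lemma skew_preserves_rectangle:
  assumes "E \<in> sets P" "F \<in> sets N"
  shows "measure (P \<Otimes>\<^sub>M N) (skew_overlap (E \<times> F) (space P \<times> space N) v) = prob E * N.prob F"
proof -
  have "base_corr F (space N) n = N.prob F" for n
    using measure_distr[OF U_measurable assms(2), of n] by (simp add: base_corr_def distr_U)
  moreover have "prob (shift_conf v -` E \<inter> space P) = prob E"
    using measure_distr[OF measurable_shift assms(1), of v] by (simp add: distr_shift)
  ultimately show ?thesis
    using measure_skew_overlap[of E "space P" F "space N" v] assms measurable_sets[OF measurable_shift assms(1), of v]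
    by simp
qed

lemma base_corr_cesaro:
  assumes F: "F \<in> sets N" "F' \<in> sets N"
  defines "q \<equiv> N.prob F * N.prob F'"
  shows "(\<lambda>n. (\<Sum>k<n. \<bar>base_corr F F' (int k) - q\<bar> + \<bar>base_corr F F' (- int k) - q\<bar>) / real n) \<longlonglongrightarrow> 0"
proof -
  let ?f = "\<lambda>g. \<bar>base_corr F F' g - q\<bar>"
  let ?B = "\<lambda>R::real. {g::int. \<bar>real_of_int g\<bar> \<le> R}"
  have "((\<lambda>R. 1 / (2 * R) * (\<Sum>g\<in>?B R. ?f (- g))) \<longlongrightarrow> 0) at_top"
    using U_mixing F unfolding weakly_mixing_Z_def base_corr_def q_def by blast
  then have "(\<lambda>n. 1 / (2 * real n) * (\<Sum>g\<in>?B (real n). ?f (- g))) \<longlonglongrightarrow> 0"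
    by (rule filterlim_compose[OF _ filterlim_real_sequentially])
  \<comment> \<open>The factor 4 turns \<open>1 / (2 * n)\<close> into \<open>2 / n\<close>: each of
    the two one-sided sums is bounded by the full sum over the window from \<open>- n\<close> to
    \<open>n\<close>.\<close>
  from tendsto_mult_left[OF this, of 4]
  have lim: "(\<lambda>n. 2 * (\<Sum>g\<in>?B (real n). ?f (- g)) / real n) \<longlonglongrightarrow> 0"
    by (simp add: field_simps)
  show ?thesis
  proof (rule tendsto_sandwich[OF _ _ tendsto_const lim])
    show "eventually (\<lambda>n. 0 \<le> (\<Sum>k<n. ?f (int k) + ?f (- int k)) / real n) sequentially"
      by (intro always_eventually allI divide_nonneg_nonneg sum_nonneg) auto
    show "eventually (\<lambda>n. (\<Sum>k<n. ?f (int k) + ?f (- int k)) / real n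
        \<le> 2 * (\<Sum>g\<in>?B (real n). ?f (- g)) / real n) sequentially"
    proof (intro always_eventually allI divide_right_mono)
      fix n :: nat
      have B: "?B (real n) = {- int n..int n}" by auto
      have "(\<Sum>k<n. ?f (int k)) = (\<Sum>g\<in>(\<lambda>k. - int k) ` {..<n}. ?f (- g))"
        by (subst sum.reindex) (auto simp: inj_on_def)
      also have "\<dots> \<le> (\<Sum>g\<in>?B (real n). ?f (- g))"
        unfolding B by (intro sum_mono2) auto
      finally have 1: "(\<Sum>k<n. ?f (int k)) \<le> (\<Sum>g\<in>?B (real n). ?f (- g))" .
      have "(\<Sum>k<n. ?f (- int k)) = (\<Sum>g\<in>int ` {..<n}. ?f (- g))"
        by (subst sum.reindex) auto
      also have "\<dots> \<le> (\<Sum>g\<in>?B (real n). ?f (- g))"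
        unfolding B by (intro sum_mono2) auto
      finally show "(\<Sum>k<n. ?f (int k) + ?f (- int k)) \<le> 2 * (\<Sum>g\<in>?B (real n). ?f (- g))"
        using 1 by (simp add: sum.distrib)
    qed simp
  qed
qed

text \<open>The deviation is dominated by a measurable \<open>u\<close> whose integral over
  \<open>{- R..R}\<close> is of order \<open>o(R)\<close>. For large times the void events decouple
  and the Poisson mean of the fibre deviations is left; small times contribute a bounded
  amount.\<close>

lemma skew_correlation_bound:
  assumes E: "E \<in> void_events" "E' \<in> void_events" and F: "F \<in> sets N" "F' \<in> sets N"
  obtains u I where "u \<in> borel_measurable borel" "\<And>v. 0 \<le> u v"
    "\<And>v. \<bar>measure (P \<Otimes>\<^sub>M N) (skew_overlap (E \<times> F) (E' \<times> F') (- v))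
        - (prob E * N.prob F) * (prob E' * N.prob F')\<bar> \<le> u v"
    "\<And>R. R \<ge> 0 \<Longrightarrow> (\<integral>\<^sup>+v. ennreal (u v) * indicator {- R..R} v \<partial>lborel) \<le> ennreal (I R)"
    "\<And>R. R \<ge> 0 \<Longrightarrow> 0 \<le> I R" "((\<lambda>R. I R / R) \<longlongrightarrow> 0) at_top"
proof -
  let ?q = "N.prob F * N.prob F'"
  let ?c = "base_corr F F'"
  let ?a = "\<lambda>v. measure (P \<Otimes>\<^sub>M N) (skew_overlap (E \<times> F) (E' \<times> F') v)"
  let ?p = "(prob E * N.prob F) * (prob E' * N.prob F')"
  \<comment> \<open>Folding both signs together makes the bound depend on the signed count only
    through its absolute value, whose law is Poisson.\<close>
  define d where "d k = \<bar>?c (int k) - ?q\<bar> + \<bar>?c (- int k) - ?q\<bar>" for k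
  have q: "0 \<le> ?q" "?q \<le> 1" by (auto intro: mult_le_one)
  have cq: "\<bar>?c k - ?q\<bar> \<le> 1" for k
    using base_corr_bounds[of F F' k] q by linarith
  have d0: "0 \<le> d n" and d2: "d n \<le> 2" for n
    using cq[of "int n"] cq[of "- int n"] by (auto simp: d_def)
  have cd: "\<bar>?c k - ?q\<bar> \<le> d (nat \<bar>k\<bar>)" for k
    by (cases "k \<ge> 0") (auto simp: d_def)
  have "(\<lambda>n. (\<Sum>k<n. d k) / real n) \<longlonglongrightarrow> 0"
    unfolding d_def by (rule base_corr_cesaro[OF F])
  then obtain FF where FF: "\<And>R. R \<ge> 0 \<Longrightarrow>
      (\<integral>\<^sup>+t. ennreal (poisson_mean d t) * indicator {0..R} t \<partial>lborel) = ennreal (FF R)"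
    "\<And>R. R \<ge> 0 \<Longrightarrow> 0 \<le> FF R" "((\<lambda>R. FF R / R) \<longlongrightarrow> 0) at_top"
    using poisson_mean_cesaro[of d 2] d0 d2 by blast
  obtain r where r: "r \<ge> 0" "\<And>v. \<bar>v\<bar> > r \<Longrightarrow> prob (shift_conf v -` E \<inter> space P \<inter> E') = prob E * prob E'"
    using shift_void_independent[OF E] by blast
  \<comment> \<open>The indicator pays for the times at which the two void events may be dependent;
    there the deviation is at most 1.\<close>
  define u where "u v = poisson_mean d \<bar>v\<bar> + indicator {- r..r} v" for v
  have db: "\<bar>d n\<bar> \<le> 2 * (real n + 1)" for n
    using d0[of n] d2[of n] by simp
  have pm0: "0 \<le> poisson_mean d t" if "t \<ge> 0" for t
    using poisson_mean_mono[of "\<lambda>_. 0" 0 d 2 t] d0 db that by (simp add: poisson_mean_const)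
  have [measurable]: "poisson_mean d \<in> borel_measurable borel"
    using DERIV_poisson_mean[OF db]
    by (intro borel_measurable_continuous_onI continuous_at_imp_continuous_on ballI DERIV_isCont)
  have u_meas: "u \<in> borel_measurable borel" unfolding u_def by measurable
  have u0: "0 \<le> u v" for v using pm0[of "\<bar>v\<bar>"] by (simp add: u_def)
  have bound: "\<bar>?a v - ?p\<bar> \<le> poisson_mean d \<bar>v\<bar> + indicator {- r..r} v" for v
  proof (cases "\<bar>v\<bar> \<le> r")
    case True
    have "0 \<le> ?p" "?p \<le> 1" by (auto intro!: mult_le_one)
    moreover have "0 \<le> ?a v" "?a v \<le> 1" by (auto intro: pair.prob_le_1)
    ultimately have "\<bar>?a v - ?p\<bar> \<le> 1" by linarith
    then show ?thesis using True pm0[of "\<bar>v\<bar>"] by (simp add: abs_le_iff)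
  next
    case False
    let ?H = "shift_conf v -` E \<inter> space P \<inter> E'"
    have [measurable]: "?H \<in> sets P"
      using measurable_sets[OF measurable_shift void_events_sets[OF E(1)]] void_events_sets[OF E(2)] by auto
    have [measurable]: "(\<lambda>A. ?c (count_conf A v)) \<in> borel_measurable P" "(\<lambda>A. d (nat \<bar>count_conf A v\<bar>)) \<in> borel_measurable P"
      by (rule measurable_compose[OF measurable_count_conf_P]; simp)+
    have i: "integrable P (\<lambda>A. indicator ?H A * ?c (count_conf A v))" "integrable P (\<lambda>A. indicator ?H A * ?q)"
    proof -
      have "AE A in P. norm (indicator ?H A * ?c (count_conf A v)) \<le> 1" "AE A in P. norm (indicator ?H A * ?q) \<le> 1"
        using base_corr_bounds q by (auto simp: indicator_def)
      then show "integrable P (\<lambda>A. indicator ?H A * ?c (count_conf A v))" "integrable P (\<lambda>A. indicator ?H A * ?q)"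
        by (auto intro: integrable_const_bound[where B = 1])
    qed
    \<comment> \<open>Independence rewrites the product of the measures as the integral of the
      constant \<open>?q\<close> over \<open>?H\<close>, so the deviation becomes an integral of
      \<open>?c - ?q\<close> over \<open>?H\<close>.\<close>
    have "?p = ?q * prob ?H" using r(2)[of v] False by simp
    also have "\<dots> = (\<integral>A. indicator ?H A * ?q \<partial>P)" by simp
    finally have "?a v - ?p = (\<integral>A. indicator ?H A * ?c (count_conf A v) \<partial>P) - (\<integral>A. indicator ?H A * ?q \<partial>P)"
      using measure_skew_overlap[OF void_events_sets void_events_sets F, OF E] by simp
    also have "\<dots> = (\<integral>A. indicator ?H A * ?c (count_conf A v) - indicator ?H A * ?q \<partial>P)"
      using i by (rule Bochner_Integration.integral_diff[symmetric])
    finally have "\<bar>?a v - ?p\<bar> = \<bar>\<integral>A. indicator ?H A * ?c (count_conf A v) - indicator ?H A * ?q \<partial>P\<bar>"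
      by simp
    also have "\<dots> \<le> (\<integral>A. d (nat \<bar>count_conf A v\<bar>) \<partial>P)"
    proof -
      have id: "integrable P (\<lambda>A. d (nat \<bar>count_conf A v\<bar>))"
        using d0 d2 by (intro integrable_const_bound[where B = 2]) auto
      have "\<bar>\<integral>A. indicator ?H A * ?c (count_conf A v) - indicator ?H A * ?q \<partial>P\<bar>
          \<le> (\<integral>A. \<bar>indicator ?H A * ?c (count_conf A v) - indicator ?H A * ?q\<bar> \<partial>P)"
        by (rule integral_abs_bound)
      also have "\<dots> \<le> (\<integral>A. d (nat \<bar>count_conf A v\<bar>) \<partial>P)"
        using cd d0 by (intro integral_mono integrable_abs Bochner_Integration.integrable_diff i id) (simp add: indicator_def)
      finally show ?thesis .
    qed
    also have "\<dots> = poisson_mean d \<bar>v\<bar>"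
      using nn_integral_abs_count_conf[of d 2 v] d2 pm0[of "\<bar>v\<bar>"] d0
      by (simp add: integral_eq_nn_integral)
    finally show ?thesis by (simp add: indicator_def)
  qed
  have int: "(\<integral>\<^sup>+v. ennreal (u v) * indicator {- R..R} v \<partial>lborel) \<le> ennreal (2 * FF R + 2 * r)" if R: "R \<ge> 0" for R
  proof -
    \<comment> \<open>The even function of \<open>v\<close> is split at the origin and reflected,
      giving twice the integral over \<open>{0..R}\<close>. The origin is covered twice, which is
      harmless for an upper bound.\<close>
    let ?g = "\<lambda>v. ennreal (poisson_mean d v) * indicator {0..R} v"
    have m: "?g \<in> borel_measurable lborel" "(\<lambda>v. ?g (- v)) \<in> borel_measurable lborel" by measurable
    have "(\<integral>\<^sup>+v. ennreal (u v) * indicator {- R..R} v \<partial>lborel)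
        \<le> (\<integral>\<^sup>+v. ?g v + ?g (- v) + indicator {- r..r} v \<partial>lborel)"
    proof (rule nn_integral_mono)
      fix v :: real
      have "ennreal (u v) = ennreal (poisson_mean d \<bar>v\<bar>) + indicator {- r..r} v"
        using pm0[of "\<bar>v\<bar>"] by (simp add: u_def ennreal_plus ennreal_indicator)
      then show "ennreal (u v) * indicator {- R..R} v \<le> ?g v + ?g (- v) + indicator {- r..r} v"
        by (cases "v \<ge> 0") (auto simp: indicator_def)
    qed
    also have "\<dots> = (\<integral>\<^sup>+v. ?g v \<partial>lborel) + (\<integral>\<^sup>+v. ?g (- v) \<partial>lborel) + (\<integral>\<^sup>+v. indicator {- r..r} v \<partial>lborel)"
      using m by (simp add: nn_integral_add)
    also have "(\<integral>\<^sup>+v. ?g (- v) \<partial>lborel) = (\<integral>\<^sup>+v. ?g v \<partial>lborel)"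
      using nn_integral_real_affine[of ?g "- 1" 0] by simp
    also have "(\<integral>\<^sup>+v. indicator {- r..r} v \<partial>lborel) = ennreal (2 * r)"
      using r(1) by simp
    finally show ?thesis using FF(1,2)[OF R] r(1) by (simp add: ennreal_plus[symmetric] del: ennreal_plus)
  qed
  have "((\<lambda>R. 2 * (FF R / R) + 2 * r / R) \<longlongrightarrow> 2 * 0 + 0) at_top"
    by (intro tendsto_add tendsto_mult FF(3) tendsto_const) real_asymp
  then have lim: "((\<lambda>R. (2 * FF R + 2 * r) / R) \<longlongrightarrow> 0) at_top"
    by (simp add: add_divide_distrib)
  show ?thesis
  proof (rule that[OF u_meas u0 _ int _ lim])
    fix v show "\<bar>?a (- v) - ?p\<bar> \<le> u v"
      using bound[of "- v"] by (simp add: u_def indicator_def abs_le_iff conj_commute minus_le_iff)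
  qed (use FF(2) r(1) in auto)
qed

end

section \<open>The two-parameter system\<close>

text \<open>The coordinates of the system come in the order configuration, configuration, fibre,
  fibre, while each skew product uses one of each kind. Integrating out \<open>a\<close> and then
  \<open>b\<close> leaves a rectangle in the last two coordinates, so arbitrary measurable
  \<open>S\<close> and \<open>S'\<close> multiply without permuting the space.\<close>

lemma emeasure_interleaved_Times:
  assumes N: "sigma_finite_measure Q" "sigma_finite_measure N1" "sigma_finite_measure N2"
    and S: "S \<in> sets (P \<Otimes>\<^sub>M N1)" "S' \<in> sets (Q \<Otimes>\<^sub>M N2)"
  defines "I \<equiv> {(a, b, x, y). (a, x) \<in> S \<and> (b, y) \<in> S'}"
  shows "I \<in> sets (P \<Otimes>\<^sub>M Q \<Otimes>\<^sub>M N1 \<Otimes>\<^sub>M N2)"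
    and "emeasure (P \<Otimes>\<^sub>M Q \<Otimes>\<^sub>M N1 \<Otimes>\<^sub>M N2) I = emeasure (P \<Otimes>\<^sub>M N1) S * emeasure (Q \<Otimes>\<^sub>M N2) S'"
proof -
  interpret Q: sigma_finite_measure Q by fact
  interpret N1: sigma_finite_measure N1 by fact
  interpret N2: sigma_finite_measure N2 by fact
  interpret N: pair_sigma_finite N1 N2 ..
  interpret QN: pair_sigma_finite Q "N1 \<Otimes>\<^sub>M N2" ..
  have "I = {\<omega> \<in> space (P \<Otimes>\<^sub>M Q \<Otimes>\<^sub>M N1 \<Otimes>\<^sub>M N2).
      (fst \<omega>, fst (snd (snd \<omega>))) \<in> S \<and> (fst (snd \<omega>), snd (snd (snd \<omega>))) \<in> S'}"
    using S[THEN sets.sets_into_space] by (auto simp: I_def space_pair_measure)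
  also have "\<dots> \<in> sets (P \<Otimes>\<^sub>M Q \<Otimes>\<^sub>M N1 \<Otimes>\<^sub>M N2)"
    using S by measurable
  finally show I: "I \<in> sets (P \<Otimes>\<^sub>M Q \<Otimes>\<^sub>M N1 \<Otimes>\<^sub>M N2)" .
  have [measurable]: "(\<lambda>b. emeasure N2 (Pair b -` S')) \<in> borel_measurable Q"
      "(\<lambda>a. emeasure N1 (Pair a -` S)) \<in> borel_measurable P"
    using N1.measurable_emeasure_Pair[OF S(1)] N2.measurable_emeasure_Pair[OF S(2)] by auto
  have slice: "Pair a -` S \<in> sets N1" "Pair b -` S' \<in> sets N2" for a b
    using S by (auto intro: sets_Pair1)
  have "emeasure (P \<Otimes>\<^sub>M Q \<Otimes>\<^sub>M N1 \<Otimes>\<^sub>M N2) I = (\<integral>\<^sup>+\<omega>. indicator I \<omega> \<partial>(P \<Otimes>\<^sub>M Q \<Otimes>\<^sub>M N1 \<Otimes>\<^sub>M N2))"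
    using I by simp
  also have "\<dots> = (\<integral>\<^sup>+a. (\<integral>\<^sup>+t. indicator I (a, t) \<partial>(Q \<Otimes>\<^sub>M N1 \<Otimes>\<^sub>M N2)) \<partial>P)"
    using I by (intro QN.nn_integral_fst[symmetric]) simp
  also have "\<dots> = (\<integral>\<^sup>+a. emeasure N1 (Pair a -` S) * emeasure (Q \<Otimes>\<^sub>M N2) S' \<partial>P)"
  proof (rule nn_integral_cong)
    fix a
    have Ia: "Pair a -` I \<in> sets (Q \<Otimes>\<^sub>M N1 \<Otimes>\<^sub>M N2)" using I by (rule sets_Pair1)
    have "(\<integral>\<^sup>+t. indicator I (a, t) \<partial>(Q \<Otimes>\<^sub>M N1 \<Otimes>\<^sub>M N2))
        = (\<integral>\<^sup>+t. indicator (Pair a -` I) t \<partial>(Q \<Otimes>\<^sub>M N1 \<Otimes>\<^sub>M N2))"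
      by (auto intro!: nn_integral_cong simp: indicator_def)
    also have "\<dots> = (\<integral>\<^sup>+b. (\<integral>\<^sup>+t. indicator (Pair a -` I) (b, t) \<partial>(N1 \<Otimes>\<^sub>M N2)) \<partial>Q)"
      using Ia by (intro N.nn_integral_fst[symmetric]) simp
    also have "\<dots> = (\<integral>\<^sup>+b. emeasure N1 (Pair a -` S) * emeasure N2 (Pair b -` S') \<partial>Q)"
    proof (rule nn_integral_cong)
      fix b
      have "(\<integral>\<^sup>+t. indicator (Pair a -` I) (b, t) \<partial>(N1 \<Otimes>\<^sub>M N2))
          = (\<integral>\<^sup>+t. indicator ((Pair a -` S) \<times> (Pair b -` S')) t \<partial>(N1 \<Otimes>\<^sub>M N2))"
        by (auto intro!: nn_integral_cong simp: indicator_def I_def)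
      also have "\<dots> = emeasure N1 (Pair a -` S) * emeasure N2 (Pair b -` S')"
        using slice by (simp add: N2.emeasure_pair_measure_Times)
      finally show "(\<integral>\<^sup>+t. indicator (Pair a -` I) (b, t) \<partial>(N1 \<Otimes>\<^sub>M N2))
          = emeasure N1 (Pair a -` S) * emeasure N2 (Pair b -` S')" .
    qed
    also have "\<dots> = emeasure N1 (Pair a -` S) * emeasure (Q \<Otimes>\<^sub>M N2) S'"
      using S by (simp add: nn_integral_cmult N2.emeasure_pair_measure_alt)
    finally show "(\<integral>\<^sup>+t. indicator I (a, t) \<partial>(Q \<Otimes>\<^sub>M N1 \<Otimes>\<^sub>M N2))
        = emeasure N1 (Pair a -` S) * emeasure (Q \<Otimes>\<^sub>M N2) S'" .
  qed
  also have "\<dots> = emeasure (P \<Otimes>\<^sub>M N1) S * emeasure (Q \<Otimes>\<^sub>M N2) S'"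
    using S by (simp add: nn_integral_multc N1.emeasure_pair_measure_alt)
  finally show "emeasure (P \<Otimes>\<^sub>M Q \<Otimes>\<^sub>M N1 \<Otimes>\<^sub>M N2) I = emeasure (P \<Otimes>\<^sub>M N1) S * emeasure (Q \<Otimes>\<^sub>M N2) S'" .
qed

text \<open>Integrating a function of one coordinate over the square gives \<open>2 * R\<close>
  times its one-dimensional integral; division by the area leaves
  \<open>(I + I') / (2 * R)\<close>.\<close>

lemma square_mean_split_bound:
  assumes f: "f \<in> borel_measurable borel" "\<And>g. 0 \<le> f g" "\<And>g. f g \<le> K"
    and u: "u \<in> borel_measurable borel" "u' \<in> borel_measurable borel" "\<And>v. 0 \<le> u v" "\<And>v. 0 \<le> u' v"
    and le: "\<And>v w. f (v, w) \<le> u v + u' w"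
    and I: "(\<integral>\<^sup>+v. ennreal (u v) * indicator {- R..R} v \<partial>lborel) \<le> ennreal I"
      "(\<integral>\<^sup>+v. ennreal (u' v) * indicator {- R..R} v \<partial>lborel) \<le> ennreal I'" "0 \<le> I" "0 \<le> I'"
    and R: "R > 0"
  shows "square_mean f R \<le> (I + I') / (2 * R)"
proof -
  let ?Q = "cbox (- R, - R) (R, R)" and ?J = "{- R..R}"
  have cb: "?Q = ?J \<times> ?J" by (auto simp: cbox_Pair_eq)
  note [measurable] = u(1,2)
  have int: "f integrable_on ?Q"
    using f by (intro bounded_measurable_integrable_on_cbox[of f K]) auto
  \<comment> \<open>The gauge integral is exchanged for a nonnegative Lebesgue integral so that
    Tonelli applies.\<close>
  have "(\<integral>\<^sup>+g. ennreal (f g) * indicator ?Q g \<partial>lborel) = ennreal (integral ?Q f)"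
    using f int by (intro nn_integral_has_integral_lebesgue') (auto simp: integrable_integral)
  then have "ennreal (integral ?Q f) = (\<integral>\<^sup>+g. ennreal (f g) * indicator ?Q g \<partial>(lborel \<Otimes>\<^sub>M lborel))"
    by (simp add: lborel_prod)
  also have "\<dots> \<le> (\<integral>\<^sup>+g. (ennreal (u (fst g)) + ennreal (u' (snd g))) * indicator ?Q g \<partial>(lborel \<Otimes>\<^sub>M lborel))"
    using le u(3,4) by (intro nn_integral_mono) (auto simp: indicator_def ennreal_plus[symmetric] simp del: ennreal_plus intro!: ennreal_leI)
  also have "\<dots> = (\<integral>\<^sup>+v. (\<integral>\<^sup>+w. (ennreal (u v) + ennreal (u' w)) * indicator ?J v * indicator ?J w \<partial>lborel) \<partial>lborel)"
    by (subst lborel.nn_integral_fst[symmetric]) (auto simp: cb indicator_times mult.assoc)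
  also have "\<dots> = (\<integral>\<^sup>+v. (ennreal (u v) * indicator ?J v) * ennreal (2 * R)
      + indicator ?J v * (\<integral>\<^sup>+w. ennreal (u' w) * indicator ?J w \<partial>lborel) \<partial>lborel)"
  proof (rule nn_integral_cong)
    fix v :: real
    have "(\<integral>\<^sup>+w. (ennreal (u v) + ennreal (u' w)) * indicator ?J v * indicator ?J w \<partial>lborel)
        = (\<integral>\<^sup>+w. ennreal (u v) * indicator ?J v * indicator ?J w + indicator ?J v * (ennreal (u' w) * indicator ?J w) \<partial>lborel)"
      by (intro nn_integral_cong) (simp add: algebra_simps)
    also have "\<dots> = (\<integral>\<^sup>+w. ennreal (u v) * indicator ?J v * indicator ?J w \<partial>lborel)
        + (\<integral>\<^sup>+w. indicator ?J v * (ennreal (u' w) * indicator ?J w) \<partial>lborel)"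
      by (rule nn_integral_add) measurable
    finally show "(\<integral>\<^sup>+w. (ennreal (u v) + ennreal (u' w)) * indicator ?J v * indicator ?J w \<partial>lborel)
        = (ennreal (u v) * indicator ?J v) * ennreal (2 * R)
          + indicator ?J v * (\<integral>\<^sup>+w. ennreal (u' w) * indicator ?J w \<partial>lborel)"
      using R by (simp add: nn_integral_cmult nn_integral_cmult_indicator)
  qed
  also have "\<dots> = (\<integral>\<^sup>+v. ennreal (u v) * indicator ?J v \<partial>lborel) * ennreal (2 * R)
      + ennreal (2 * R) * (\<integral>\<^sup>+w. ennreal (u' w) * indicator ?J w \<partial>lborel)"
    using R by (simp add: nn_integral_add nn_integral_multc)
  also have "\<dots> \<le> ennreal I * ennreal (2 * R) + ennreal (2 * R) * ennreal I'"
    using I by (intro add_mono mult_mono) auto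
  also have "\<dots> = ennreal ((I + I') * (2 * R))"
    using I R by (simp add: ennreal_mult[symmetric] ennreal_plus[symmetric] algebra_simps del: ennreal_plus)
  finally have "integral ?Q f \<le> (I + I') * (2 * R)"
    using I R by (subst (asm) ennreal_le_iff) auto
  then have "1 / (2 * R)\<^sup>2 * integral ?Q f \<le> 1 / (2 * R)\<^sup>2 * ((I + I') * (2 * R))"
    by (intro mult_left_mono) auto
  also have "\<dots> = (I + I') / (2 * R)" using R by (simp add: field_simps power2_eq_square)
  finally show ?thesis by (simp add: square_mean_def)
qed

locale poisson_skew_product_pair =
  X: poisson_skew_product P N1 U1 + Y: poisson_skew_product P N2 U2
  for P and N1 :: "'b measure" and U1 and N2 :: "'c measure" and U2
begin

abbreviation (input) M :: "(real set \<times> real set \<times> 'b \<times> 'c) measure" where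
  "M \<equiv> P \<Otimes>\<^sub>M P \<Otimes>\<^sub>M N1 \<Otimes>\<^sub>M N2"

definition T :: "real \<times> real \<Rightarrow> real set \<times> real set \<times> 'b \<times> 'c \<Rightarrow> real set \<times> real set \<times> 'b \<times> 'c" where
  "T = (\<lambda>(v, w) (\<mu>, \<nu>, x, y). (shift_conf v \<mu>, shift_conf w \<nu>, U1 (count_conf \<mu> v) x, U2 (count_conf \<nu> w) y))"

text \<open>Void events in the configuration coordinates, where independence is explicit, and
  arbitrary measurable sets in the fibres, where weak mixing is assumed.\<close>

definition void_rectangles :: "(real set \<times> real set \<times> 'b \<times> 'c) set set" where
  "void_rectangles = {E1 \<times> E2 \<times> F1 \<times> F2 | E1 E2 F1 F2.
     E1 \<in> void_events \<and> E2 \<in> void_events \<and> F1 \<in> sets N1 \<and> F2 \<in> sets N2}"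

sublocale N12: pair_prob_space N1 N2 ..
sublocale PN12: pair_prob_space P "N1 \<Otimes>\<^sub>M N2" ..
sublocale M: pair_prob_space P "P \<Otimes>\<^sub>M N1 \<Otimes>\<^sub>M N2" ..

lemma void_rectangles_subset: "void_rectangles \<subseteq> Pow (space M)"
  using void_events_subset sets.sets_into_space[of _ N1] sets.sets_into_space[of _ N2]
  unfolding void_rectangles_def by (fastforce simp: space_pair_measure X.space_P)

text \<open>Products of generators generate the product as soon as the generators contain the whole
  spaces. This is applied twice, attaching one configuration coordinate at a time to the two
  fibres.\<close>

lemma sets_M_void_rectangles: "sets M = sigma_sets (space M) void_rectangles"
proof -
  let ?G = "{c \<times> d |c d. c \<in> sets N1 \<and> d \<in> sets N2}"
  let ?G' = "{b \<times> cd |b cd. b \<in> void_events \<and> cd \<in> ?G}"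
  have G: "?G \<subseteq> Pow (space (N1 \<Otimes>\<^sub>M N2))" "sets (N1 \<Otimes>\<^sub>M N2) = sigma_sets (space (N1 \<Otimes>\<^sub>M N2)) ?G"
    using pair_measure_closed[of N1 N2] by (simp_all add: space_pair_measure sets_pair_measure)
  have P: "void_events \<subseteq> Pow (space P)" "sets P = sigma_sets (space P) void_events"
      "{space P} \<subseteq> void_events"
    using void_events_subset X.sets_P space_in_void_events by (auto simp: X.space_P sets_config_space_void)
  have "space (N1 \<Otimes>\<^sub>M N2) \<in> ?G" by (auto simp: space_pair_measure)
  then have G': "sets (P \<Otimes>\<^sub>M N1 \<Otimes>\<^sub>M N2) = sets (sigma (space P \<times> space (N1 \<Otimes>\<^sub>M N2)) ?G')"
    using P G by (intro sets_pair_eq[where Ca = "{space P}" and Cb = "{space (N1 \<Otimes>\<^sub>M N2)}"]) auto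
  have G's: "?G' \<subseteq> Pow (space (P \<Otimes>\<^sub>M N1 \<Otimes>\<^sub>M N2))"
    using P(1) sets.sets_into_space[of _ N1] sets.sets_into_space[of _ N2] by (fastforce simp: space_pair_measure)
  have "space (P \<Otimes>\<^sub>M N1 \<Otimes>\<^sub>M N2) \<in> ?G'"
    using P(3) \<open>space (N1 \<Otimes>\<^sub>M N2) \<in> ?G\<close> by (subst space_pair_measure) blast
  moreover have "sets (P \<Otimes>\<^sub>M N1 \<Otimes>\<^sub>M N2) = sigma_sets (space (P \<Otimes>\<^sub>M N1 \<Otimes>\<^sub>M N2)) ?G'"
    using G' G's by (simp add: space_pair_measure)
  ultimately have "sets M = sets (sigma (space P \<times> space (P \<Otimes>\<^sub>M N1 \<Otimes>\<^sub>M N2)) {a \<times> t |a t. a \<in> void_events \<and> t \<in> ?G'})"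
    using P G's by (intro sets_pair_eq[where Ca = "{space P}" and Cb = "{space (P \<Otimes>\<^sub>M N1 \<Otimes>\<^sub>M N2)}"]) auto
  also have "{a \<times> t |a t. a \<in> void_events \<and> t \<in> ?G'} = void_rectangles"
    unfolding void_rectangles_def by blast
  also have "space P \<times> space (P \<Otimes>\<^sub>M N1 \<Otimes>\<^sub>M N2) = space M" by (simp add: space_pair_measure)
  finally show ?thesis using void_rectangles_subset by simp
qed

lemma Int_stable_void_rectangles: "Int_stable void_rectangles"
proof (rule Int_stableI)
  fix A B assume "A \<in> void_rectangles" "B \<in> void_rectangles"
  then obtain E1 E2 F1 F2 E1' E2' F1' F2' where
    "A = E1 \<times> E2 \<times> F1 \<times> F2" "B = E1' \<times> E2' \<times> F1' \<times> F2'"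
    and "E1 \<in> void_events" "E2 \<in> void_events" "F1 \<in> sets N1" "F2 \<in> sets N2"
    "E1' \<in> void_events" "E2' \<in> void_events" "F1' \<in> sets N1" "F2' \<in> sets N2"
    unfolding void_rectangles_def by blast
  moreover have "(E1 \<times> E2 \<times> F1 \<times> F2) \<inter> (E1' \<times> E2' \<times> F1' \<times> F2')
      = (E1 \<inter> E1') \<times> (E2 \<inter> E2') \<times> (F1 \<inter> F1') \<times> (F2 \<inter> F2')" by auto
  ultimately show "A \<inter> B \<in> void_rectangles"
    using Int_stableD[OF Int_stable_void_events] unfolding void_rectangles_def by blast
qed

lemma space_in_void_rectangles: "space M \<in> void_rectangles"
  using space_in_void_events unfolding void_rectangles_def
  by (auto simp: space_pair_measure X.space_P)

lemma void_rectangles_sets: "A \<in> void_rectangles \<Longrightarrow> A \<in> sets M"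
  unfolding sets_M_void_rectangles by (rule sigma_sets.Basic)

text \<open>The first and third coordinates evolve with \<open>fst g\<close>, the second and fourth
  with \<open>snd g\<close>, so the overlap is an interleaved product of two skew overlaps.\<close>

lemma measure_T_overlap:
  assumes E: "E1 \<in> sets P" "E2 \<in> sets P" "E1' \<in> sets P" "E2' \<in> sets P"
    and F: "F1 \<in> sets N1" "F1' \<in> sets N1" "F2 \<in> sets N2" "F2' \<in> sets N2"
  shows "measure M (T g -` (E1 \<times> E2 \<times> F1 \<times> F2) \<inter> space M \<inter> (E1' \<times> E2' \<times> F1' \<times> F2'))
    = measure (P \<Otimes>\<^sub>M N1) (X.skew_overlap (E1 \<times> F1) (E1' \<times> F1') (fst g))
      * measure (P \<Otimes>\<^sub>M N2) (Y.skew_overlap (E2 \<times> F2) (E2' \<times> F2') (snd g))"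
proof -
  let ?S = "X.skew_overlap (E1 \<times> F1) (E1' \<times> F1') (fst g)"
  let ?S' = "Y.skew_overlap (E2 \<times> F2) (E2' \<times> F2') (snd g)"
  have S: "?S \<in> sets (P \<Otimes>\<^sub>M N1)" "?S' \<in> sets (P \<Otimes>\<^sub>M N2)"
    using E F by (auto intro!: X.skew_overlap_sets Y.skew_overlap_sets)
  have "T g -` (E1 \<times> E2 \<times> F1 \<times> F2) \<inter> space M \<inter> (E1' \<times> E2' \<times> F1' \<times> F2')
      = {(a, b, x, y). (a, x) \<in> ?S \<and> (b, y) \<in> ?S'}"
    by (auto simp: T_def X.skew_overlap_def Y.skew_overlap_def X.skew_def Y.skew_def space_pair_measure split_beta)
  then show ?thesis
    using emeasure_interleaved_Times(2)[OF _ _ _ S]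
    by (simp add: measure_def enn2real_mult X.sigma_finite_measure_axioms X.N.sigma_finite_measure_axioms Y.N.sigma_finite_measure_axioms)
qed

lemma measure_rectangle:
  assumes "E1 \<in> sets P" "E2 \<in> sets P" "F1 \<in> sets N1" "F2 \<in> sets N2"
  shows "measure M (E1 \<times> E2 \<times> F1 \<times> F2) = (X.prob E1 * X.N.prob F1) * (X.prob E2 * Y.N.prob F2)"
  using assms by (simp add: measure_def PN12.emeasure_pair_measure_Times N12.emeasure_pair_measure_Times
      Y.N.emeasure_pair_measure_Times enn2real_mult)

section \<open>Measurability and invariance of the two-parameter system\<close>

lemma measurable_T: "(\<lambda>(g, \<omega>). T g \<omega>) \<in> borel \<Otimes>\<^sub>M M \<rightarrow>\<^sub>M M"
proof -
  have [measurable]: "fst \<in> borel_measurable (borel :: (real \<times> real) measure)"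
      "snd \<in> borel_measurable (borel :: (real \<times> real) measure)"
    by (intro borel_measurable_continuous_onI continuous_intros)+
  note [measurable] = X.measurable_skew Y.measurable_skew
  \<comment> \<open>Regrouping the coordinates presents \<open>T\<close> as two jointly measurable
    skew maps run side by side.\<close>
  have "(\<lambda>z. let p = (\<lambda>(v, \<omega>). X.skew v \<omega>) (fst (fst z), fst (snd z), fst (snd (snd (snd z))));
             q = (\<lambda>(v, \<omega>). Y.skew v \<omega>) (snd (fst z), fst (snd (snd z)), snd (snd (snd (snd z))))
         in (fst p, fst q, snd p, snd q)) \<in> borel \<Otimes>\<^sub>M M \<rightarrow>\<^sub>M M"
    unfolding Let_def by measurable
  then show ?thesis by (simp add: T_def X.skew_def Y.skew_def split_beta' Let_def)
qed

lemma measurable_T1[measurable]: "T g \<in> M \<rightarrow>\<^sub>M M"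
  using measurable_Pair_compose_split[OF measurable_T, of "\<lambda>_. g" M "\<lambda>x. x"] by simp

lemma distr_T: "distr M M (T g) = M"
proof (rule measure_eqI_generator_eq[OF Int_stable_void_rectangles void_rectangles_subset])
  fix A assume A: "A \<in> void_rectangles"
  then obtain E1 E2 F1 F2 where AE: "A = E1 \<times> E2 \<times> F1 \<times> F2"
    and E: "E1 \<in> void_events" "E2 \<in> void_events" and F: "F1 \<in> sets N1" "F2 \<in> sets N2"
    unfolding void_rectangles_def by blast
  note E' = X.void_events_sets[OF E(1)] X.void_events_sets[OF E(2)]
  \<comment> \<open>Writing the whole space as a rectangle lets the overlap formula compute the
    measure of a preimage.\<close>
  have "T g -` A \<inter> space M = T g -` A \<inter> space M \<inter> (space P \<times> space P \<times> space N1 \<times> space N2)"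
    by (auto simp: space_pair_measure)
  then have "measure M (T g -` A \<inter> space M) = measure M A"
    unfolding AE measure_rectangle[OF E' F]
    using measure_T_overlap[OF E' sets.top sets.top F(1) sets.top F(2) sets.top, of g]
      X.skew_preserves_rectangle[OF E'(1) F(1)] Y.skew_preserves_rectangle[OF E'(2) F(2)]
    by simp
  then show "emeasure (distr M M (T g)) A = emeasure M A"
    using void_rectangles_sets[OF A] by (simp add: emeasure_distr M.emeasure_eq_measure)
next
  show "range (\<lambda>_. space M) \<subseteq> void_rectangles" using space_in_void_rectangles by auto
  show "emeasure (distr M M (T g)) (space M) \<noteq> \<infinity>" for i :: nat
    using prob_space.emeasure_space_1[OF M.prob_space_distr[OF measurable_T1[of g]]] by simp
qed (auto simp: sets_M_void_rectangles)

section \<open>Averaged decay of correlations, from void rectangles to all measurable sets\<close>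

definition corr :: "(real set \<times> real set \<times> 'b \<times> 'c) set \<Rightarrow> (real set \<times> real set \<times> 'b \<times> 'c) set \<Rightarrow> real \<times> real \<Rightarrow> real" where
  "corr A B g = measure M (T (- g) -` A \<inter> space M \<inter> B)"

lemma corr_sets: "A \<in> sets M \<Longrightarrow> B \<in> sets M \<Longrightarrow> T g -` A \<inter> space M \<inter> B \<in> sets M"
  using measurable_sets[OF measurable_T1] by auto

text \<open>The overlap at \<open>g\<close> is the section of a set measurable jointly in time and
  state; the joint measurability of \<open>T\<close> enters here.\<close>

lemma corr_measurable:
  assumes A: "A \<in> sets M" and B: "B \<in> sets M"
  shows "corr A B \<in> borel_measurable borel"
proof -
  let ?S = "{z \<in> space (borel \<Otimes>\<^sub>M M). T (- fst z) (snd z) \<in> A \<and> snd z \<in> B}"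
  have "(\<lambda>z. (- fst z, snd z)) \<in> borel \<Otimes>\<^sub>M M \<rightarrow>\<^sub>M (borel :: (real \<times> real) measure) \<Otimes>\<^sub>M M" by measurable
  from measurable_compose[OF this measurable_T]
  have [measurable]: "(\<lambda>z. T (- fst z) (snd z)) \<in> borel \<Otimes>\<^sub>M M \<rightarrow>\<^sub>M M" by simp
  have "?S \<in> sets (borel \<Otimes>\<^sub>M M)" using A B by measurable
  then have "(\<lambda>g. measure M (Pair g -` ?S)) \<in> borel_measurable borel"
    unfolding measure_def by (intro borel_measurable_enn2real M.measurable_emeasure_Pair)
  also have "(\<lambda>g. measure M (Pair g -` ?S)) = corr A B"
    using sets.sets_into_space[OF B] by (auto simp: corr_def fun_eq_iff space_pair_measure intro!: arg_cong[of _ _ "measure M"])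
  finally show ?thesis .
qed

lemma corr_nonneg: "0 \<le> corr A B g"
  by (simp add: corr_def)

lemma corr_le:
  assumes "A \<in> sets M" "B \<in> sets M"
  shows "corr A B g \<le> measure M A" "corr A B g \<le> measure M B"
proof -
  have m: "T (- g) -` A \<inter> space M \<in> sets M" using measurable_sets[OF measurable_T1 assms(1)] .
  have "corr A B g \<le> measure M (T (- g) -` A \<inter> space M)"
    unfolding corr_def using m by (intro M.finite_measure_mono) auto
  also have "\<dots> = measure M A"
    using measure_distr[OF measurable_T1 assms(1), of "- g"] by (simp add: distr_T)
  finally show "corr A B g \<le> measure M A" .
  show "corr A B g \<le> measure M B"
    unfolding corr_def using assms(2) by (intro M.finite_measure_mono) auto
qed

text \<open>On rectangles both the overlap and its limit factorise, so the deviation is at most a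
  function of \<open>v\<close> plus a function of \<open>w\<close>, each with integral of order
  \<open>o(R)\<close>.\<close>

lemma corr_void_rectangles:
  assumes A: "A \<in> void_rectangles" and B: "B \<in> void_rectangles"
  shows "(square_mean (\<lambda>g. \<bar>corr A B g - measure M A * measure M B\<bar>) \<longlongrightarrow> 0) at_top"
proof -
  from A obtain E1 E2 F1 F2 where AE: "A = E1 \<times> E2 \<times> F1 \<times> F2"
    and E: "E1 \<in> void_events" "E2 \<in> void_events" and F: "F1 \<in> sets N1" "F2 \<in> sets N2"
    unfolding void_rectangles_def by blast
  from B obtain E1' E2' F1' F2' where BE: "B = E1' \<times> E2' \<times> F1' \<times> F2'"
    and E': "E1' \<in> void_events" "E2' \<in> void_events" and F': "F1' \<in> sets N1" "F2' \<in> sets N2"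
    unfolding void_rectangles_def by blast
  note ES = X.void_events_sets[OF E(1)] X.void_events_sets[OF E(2)]
    and ES' = X.void_events_sets[OF E'(1)] X.void_events_sets[OF E'(2)]
  let ?a = "\<lambda>v. measure (P \<Otimes>\<^sub>M N1) (X.skew_overlap (E1 \<times> F1) (E1' \<times> F1') (- v))"
  let ?b = "\<lambda>w. measure (P \<Otimes>\<^sub>M N2) (Y.skew_overlap (E2 \<times> F2) (E2' \<times> F2') (- w))"
  let ?p = "(X.prob E1 * X.N.prob F1) * (X.prob E1' * X.N.prob F1')"
  let ?q = "(X.prob E2 * Y.N.prob F2) * (X.prob E2' * Y.N.prob F2')"
  let ?f = "\<lambda>g. \<bar>corr A B g - measure M A * measure M B\<bar>"
  obtain u I where u: "u \<in> borel_measurable borel" "\<And>v. 0 \<le> u v" "\<And>v. \<bar>?a v - ?p\<bar> \<le> u v"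
    "\<And>R. R \<ge> 0 \<Longrightarrow> (\<integral>\<^sup>+v. ennreal (u v) * indicator {- R..R} v \<partial>lborel) \<le> ennreal (I R)"
    "\<And>R. R \<ge> 0 \<Longrightarrow> 0 \<le> I R" "((\<lambda>R. I R / R) \<longlongrightarrow> 0) at_top"
    using X.skew_correlation_bound[OF E(1) E'(1) F(1) F'(1)] by blast
  obtain u' I' where u': "u' \<in> borel_measurable borel" "\<And>v. 0 \<le> u' v" "\<And>v. \<bar>?b v - ?q\<bar> \<le> u' v"
    "\<And>R. R \<ge> 0 \<Longrightarrow> (\<integral>\<^sup>+v. ennreal (u' v) * indicator {- R..R} v \<partial>lborel) \<le> ennreal (I' R)"
    "\<And>R. R \<ge> 0 \<Longrightarrow> 0 \<le> I' R" "((\<lambda>R. I' R / R) \<longlongrightarrow> 0) at_top"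
    using Y.skew_correlation_bound[OF E(2) E'(2) F(2) F'(2)] by blast
  have q: "0 \<le> ?q" "?q \<le> 1" by (auto intro!: mult_le_one)
  have a: "0 \<le> ?a v" "?a v \<le> 1" for v by (auto intro: X.pair.prob_le_1)
  have bound: "?f (v, w) \<le> u v + u' w" for v w
  proof -
    have "measure M A * measure M B = ?p * ?q"
      unfolding AE BE measure_rectangle[OF ES F] measure_rectangle[OF ES' F'] by (simp add: mult_ac)
    moreover have "corr A B (v, w) = ?a v * ?b w"
      unfolding corr_def AE BE using measure_T_overlap[OF ES ES' F(1) F'(1) F(2) F'(2), of "- (v, w)"] by simp
    \<comment> \<open>The telescoping identity
      \<open>a * b - p * q = a * (b - q) + (a - p) * q\<close>; the factors \<open>a\<close> and
      \<open>q\<close> lie between 0 and 1.\<close>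
    ultimately have "corr A B (v, w) - measure M A * measure M B = ?a v * (?b w - ?q) + (?a v - ?p) * ?q"
      by (simp add: algebra_simps)
    then have "?f (v, w) \<le> \<bar>?a v\<bar> * \<bar>?b w - ?q\<bar> + \<bar>?a v - ?p\<bar> * \<bar>?q\<bar>"
      using abs_triangle_ineq[of "?a v * (?b w - ?q)" "(?a v - ?p) * ?q"] by (simp only: abs_mult)
    also have "\<dots> \<le> 1 * \<bar>?b w - ?q\<bar> + \<bar>?a v - ?p\<bar> * 1"
      using a[of v] q by (intro add_mono mult_right_mono mult_left_mono) auto
    also have "\<dots> \<le> u' w + u v"
      unfolding mult_1_left mult_1_right by (intro add_mono u(3) u'(3))
    finally show ?thesis by (simp only: add.commute[of "u v"])
  qed
  have AB: "A \<in> sets M" "B \<in> sets M" using A B void_rectangles_sets by auto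
  have f_le: "?f g \<le> 1" for g
  proof -
    have "0 \<le> corr A B g" "corr A B g \<le> 1"
      by (auto simp: corr_def intro: M.prob_le_1)
    moreover have "0 \<le> measure M A * measure M B" "measure M A * measure M B \<le> 1"
      by (auto intro!: mult_le_one)
    ultimately show ?thesis by linarith
  qed
  have lim: "((\<lambda>R. (I R / R + I' R / R) / 2) \<longlongrightarrow> 0) at_top"
    using tendsto_divide[OF tendsto_add[OF u(6) u'(6)] tendsto_const[of 2]] by simp
  show ?thesis
  proof (rule tendsto_sandwich[OF _ _ tendsto_const lim])
    show "eventually (\<lambda>R. 0 \<le> square_mean ?f R) at_top"
      by (intro always_eventually allI square_mean_nonneg) simp
    show "eventually (\<lambda>R. square_mean ?f R \<le> (I R / R + I' R / R) / 2) at_top"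
      using eventually_gt_at_top[of 0]
    proof eventually_elim
      case (elim R)
      have "?f \<in> borel_measurable borel" using corr_measurable[OF AB] by simp
      then have "square_mean ?f R \<le> (I R + I' R) / (2 * R)"
        using elim u(4,5)[of R] u'(4,5)[of R] f_le bound
        by (intro square_mean_split_bound[where u = u and u' = u' and K = 1] u(1,2) u'(1,2)) auto
      then show ?case using elim by (simp add: field_simps)
    qed
  qed
qed

lemma corr_tendsto:
  assumes A: "A \<in> sets M" and B: "B \<in> sets M"
  shows "(square_mean (\<lambda>g. \<bar>corr A B g - measure M A * measure M B\<bar>) \<longlongrightarrow> 0) at_top"
proof -
  have add1: "corr (A \<union> A') B g = corr A B g + corr A' B g"
    if "A \<in> sets M" "A' \<in> sets M" "A \<inter> A' = {}" "B \<in> sets M" for A A' B g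
  proof -
    have "T (- g) -` (A \<union> A') \<inter> space M \<inter> B
        = (T (- g) -` A \<inter> space M \<inter> B) \<union> (T (- g) -` A' \<inter> space M \<inter> B)" by auto
    then show ?thesis
      unfolding corr_def using that corr_sets by (simp only:) (intro M.finite_measure_Union, auto)
  qed
  have add2: "corr A (B \<union> B') g = corr A B g + corr A B' g"
    if "B \<in> sets M" "B' \<in> sets M" "B \<inter> B' = {}" "A \<in> sets M" for A B B' g
  proof -
    have "T (- g) -` A \<inter> space M \<inter> (B \<union> B')
        = (T (- g) -` A \<inter> space M \<inter> B) \<union> (T (- g) -` A \<inter> space M \<inter> B')" by auto
    then show ?thesis
      unfolding corr_def using that corr_sets by (simp only:) (intro M.finite_measure_Union, auto)
  qed
  note dynkin = square_mean_correlation_dynkin[OF M.prob_space_axioms sets_M_void_rectangles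
      Int_stable_void_rectangles void_rectangles_subset]
  \<comment> \<open>First pass: \<open>B\<close> stays a void rectangle while \<open>A\<close> runs
    through the \<sigma>-algebra. The total mass is that of \<open>B\<close>.\<close>
  have first: "(square_mean (\<lambda>g. \<bar>corr A B g - measure M A * measure M B\<bar>) \<longlongrightarrow> 0) at_top"
    if A: "A \<in> sets M" and B: "B \<in> void_rectangles" for A B
  proof -
    have BM: "B \<in> sets M" using void_rectangles_sets[OF B] .
    have "(square_mean (\<lambda>g. \<bar>corr A B g - measure M B * measure M A\<bar>) \<longlongrightarrow> 0) at_top"
    proof (rule dynkin[where m = "\<lambda>g A. corr A B g"])
      show "corr (space M) B g = measure M B" for g
      proof -
        have "T (- g) -` space M \<inter> space M \<inter> B = B"
          using measurable_space[OF measurable_T1] sets.sets_into_space[OF BM] by blast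
        then show ?thesis by (simp add: corr_def)
      qed
      show "(square_mean (\<lambda>g. \<bar>corr A B g - measure M B * measure M A\<bar>) \<longlongrightarrow> 0) at_top"
        if "A \<in> void_rectangles" for A
        using corr_void_rectangles[OF that B] by (simp add: mult.commute)
    qed ((rule A corr_measurable[OF _ BM] corr_nonneg corr_le(1)[OF _ BM] add1[OF _ _ _ BM]; assumption)+)
    then show ?thesis by (simp add: mult.commute)
  qed
  show ?thesis
  \<comment> \<open>Second pass: \<open>A\<close> is now any fixed measurable set and
    \<open>B\<close> varies. The total mass is that of \<open>A\<close> because \<open>T\<close>
    preserves the measure, and the first pass is the base case.\<close>
  proof (rule dynkin[where m = "\<lambda>g B. corr A B g"])
    show "corr A (space M) g = measure M A" for g
    proof -
      have "T (- g) -` A \<inter> space M \<inter> space M = T (- g) -` A \<inter> space M" by blast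
      then show ?thesis
        using measure_distr[OF measurable_T1 A, of "- g"] by (simp add: corr_def distr_T)
    qed
  qed ((rule B corr_measurable[OF A] corr_nonneg corr_le(2)[OF A] add2[OF _ _ _ A] first[OF A]; assumption)+)
qed

theorem weakly_mixing: "weakly_mixing_R2 M T"
  unfolding weakly_mixing_R2_def
proof (intro conjI ballI allI)
  show "prob_space M" by (rule M.prob_space_axioms)
  show "T g \<in> measure_preserving M M" for g
    using measurable_T1 distr_T by (simp add: measure_preserving_def)
  show "(\<lambda>(g, \<omega>). T g \<omega>) \<in> borel \<Otimes>\<^sub>M M \<rightarrow>\<^sub>M M" by (rule measurable_T)
  show "((\<lambda>R. 1 / (2 * R)\<^sup>2 * integral (cbox (- R, - R) (R, R))
      (\<lambda>g. \<bar>measure M (T (- g) -` A \<inter> space M \<inter> B) - measure M A * measure M B\<bar>)) \<longlongrightarrow> 0) at_top"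
    if "A \<in> sets M" "B \<in> sets M" for A B
    using corr_tendsto[OF that] unfolding square_mean_def corr_def .
qed

end

theorem theorem4:
  fixes P :: "real set measure" and S1 S2 :: "real \<Rightarrow> real"
  assumes "poisson_pp P"
    and "bij_betw S1 {0..<1} {0..<1}" and "bij_betw S2 {0..<1} {0..<1}"
    and "S1 \<in> measure_preserving unit_leb unit_leb"
    and "the_inv_into {0..<1} S1 \<in> measure_preserving unit_leb unit_leb"
    and "S2 \<in> measure_preserving unit_leb unit_leb"
    and "the_inv_into {0..<1} S2 \<in> measure_preserving unit_leb unit_leb"
    and "weakly_mixing_Z unit_leb (int_iter S1 (the_inv_into {0..<1} S1))"
    and "weakly_mixing_Z unit_leb (int_iter S2 (the_inv_into {0..<1} S2))"
  shows "weakly_mixing_R2 (P \<Otimes>\<^sub>M P \<Otimes>\<^sub>M unit_leb \<Otimes>\<^sub>M unit_leb)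
           (\<lambda>(v, w) (\<mu>, \<nu>, x, y).
              (shift_conf v \<mu>, shift_conf w \<nu>,
               int_iter S1 (the_inv_into {0..<1} S1) (count_conf \<mu> v) x,
               int_iter S2 (the_inv_into {0..<1} S2) (count_conf \<nu> w) y))"
proof -
  \<comment> \<open>The families \<open>U1\<close> and \<open>U2\<close> are the integer iterates of
    the two maps; with these, \<open>T\<close> unfolds to the stated action.\<close>
  interpret poisson_skew_product_pair P unit_leb "int_iter S1 (the_inv_into {0..<1} S1)"
      unit_leb "int_iter S2 (the_inv_into {0..<1} S2)"
    using assms by unfold_locales
  show ?thesis using weakly_mixing unfolding T_def .
qed

end
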